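(* There exists $\varepsilon_0>0$ such that for every $0<\varepsilon\le\varepsilon_0$ the following holds. Let $u_0,v_0\in B\mathcal X$ satisfy $\|u_0\|_{B\mathcal X}<\varepsilon$ and $\|v_0\|_{B\mathcal X}<\varepsilon$, and let $u$ and $v$ be the global mild solutions of the Debye system with initial data $u_0$ and $v_0$, respectively, i.e. the unique solutions in $\mathscr X_{u_0}$, respectively $\mathscr X_{v_0}$, with $\sup_{t>0}t^{1/4}\|u(t)\|_{4/3}<2\varepsilon$ and $\sup_{t>0}t^{1/4}\|v(t)\|_{4/3}<2\varepsilon$. Then the relations $$\lim_{t\to\infty}t^{1/4}\|S(t)(u_0-v_0)\|_{4/3}=0$$ and $$\lim_{t\to\infty}t^{1/4}\|u(\cdot,t)-v(\cdot,t)\|_{4/3}=0$$ are equivalent.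
   Context: $\|\cdot\|_p$ is the norm of $L^p(\mathbb R^2)$. $S(t)$ is the heat semigroup on $\mathbb R^2$: $S(t)f=G(\cdot,t)*f$ with $G(x,t)=\frac1{4\pi t}e^{-|x|^2/(4t)}$, defined for tempered distributions $f\in\mathscr S'(\mathbb R^2)$. The Debye system is $u_t=\Delta u+\nabla\cdot(u\nabla\phi_u)$, $\phi_u=-E_2*u$ in $\mathbb R^2$, $u(x,0)=u_0(x)$, with $E_2(z)=\frac1{2\pi}\log|z|$; thus $\nabla\phi_u=-(\nabla E_2)*u$, i.e. $\nabla\phi_u(x)=-\frac1{2\pi}\int_{\mathbb R^2}\frac{x-y}{|x-y|^2}u(y)\,dy$. A mild solution with initial datum $u_0$ is a function satisfying, for all $t>0$, $u(t)=S(t)u_0+\int_0^t S(t-\tau)\,\nabla\cdot(u\nabla\phi_u)(\tau)\,d\tau$ (the product $u\nabla\phi_u$ is in $L^1(\mathbb R^2)$ for $u\in L^{4/3}(\mathbb R^2)$; the divergence is distributional). $B\mathcal X=\{u\in\mathscr S'(\mathbb R^2):\ \|u\|_{B\mathcal X}:=\sup_{t>0}t^{1/4}\|S(t)u\|_{4/3}<\infty\}$. $\mathscr X_{u_0}$ is the set of measurable functions $f:[0,\infty)\to B\mathcal X$ belonging to $L^\infty([0,\infty);B\mathcal X)$, attaining the initial datum $u_0$ as $t\to0^+$ in the sense of tempered distributions, and such that $f(t)\in L^{4/3}(\mathbb R^2)$ for $t>0$ with $\sup_{t>0}t^{1/4}\|f(t)\|_{4/3}<\infty$. It is known that for all sufficiently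 small $\varepsilon>0$, every $u_0\in B\mathcal X$ with $\|u_0\|_{B\mathcal X}<\varepsilon$ admits exactly one mild solution $u\in\mathscr X_{u_0}$ with $\sup_{t>0}t^{1/4}\|u(t)\|_{4/3}<2\varepsilon$; this is the solution meant in the claim. *)

theory Defs
  imports "HOL-Analysis.Analysis"
begin

type_synonym plane = "real^2"

section \<open>Schwartz functions and tempered distributions on the plane\<close>

definition partial :: "2 \<Rightarrow> (plane \<Rightarrow> real) \<Rightarrow> plane \<Rightarrow> real" where
  "partial i \<phi> x = frechet_derivative \<phi> (at x) (axis i 1)"

definition gradient :: "(plane \<Rightarrow> real) \<Rightarrow> plane \<Rightarrow> plane" where
  "gradient \<phi> x = (\<chi> i. partial i \<phi> x)"

primrec iter_partial :: "2 list \<Rightarrow> (plane \<Rightarrow> real) \<Rightarrow> plane \<Rightarrow> real" where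
  "iter_partial [] \<phi> = \<phi>"
| "iter_partial (i # is) \<phi> = partial i (iter_partial is \<phi>)"

definition smooth :: "(plane \<Rightarrow> real) \<Rightarrow> bool" where
  "smooth \<phi> \<longleftrightarrow> (\<forall>is x. iter_partial is \<phi> differentiable (at x))"

definition schwartz :: "(plane \<Rightarrow> real) set" where
  "schwartz = {\<phi>. smooth \<phi> \<and>
     (\<forall>k is. bounded (range (\<lambda>x. (1 + norm x) ^ k * iter_partial is \<phi> x)))}"

definition schwartz_seminorm :: "nat \<Rightarrow> 2 list \<Rightarrow> (plane \<Rightarrow> real) \<Rightarrow> real" where
  "schwartz_seminorm k is \<phi> = (SUP x. (1 + norm x) ^ k * \<bar>iter_partial is \<phi> x\<bar>)"

text \<open>A (real) distribution is a functional on test functions.  Its values outside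
  \<^const>\<open>schwartz\<close> are irrelevant: nothing below depends on them, and equality of
  distributions always means equality on \<^const>\<open>schwartz\<close>.  Sums and differences are the
  pointwise ones.\<close>

type_synonym distr = "(plane \<Rightarrow> real) \<Rightarrow> real"

text \<open>Linear functionals on \<^const>\<open>schwartz\<close> that are continuous for the locally convex
  topology given by the seminorms.\<close>

definition tempered :: "distr set" where
  "tempered = {T.
     (\<forall>\<phi>\<in>schwartz. \<forall>\<psi>\<in>schwartz. \<forall>a b.
        T (\<lambda>x. a * \<phi> x + b * \<psi> x) = a * T \<phi> + b * T \<psi>) \<and>
     (\<exists>C N. \<forall>\<phi>\<in>schwartz.
        \<bar>T \<phi>\<bar> \<le> C * (\<Sum>is | length is \<le> N. schwartz_seminorm N is \<phi>))}"

definition distr_of :: "(plane \<Rightarrow> real) \<Rightarrow> distr" where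
  "distr_of g \<phi> = (LINT x|lborel. g x * \<phi> x)"

definition distr_div :: "(plane \<Rightarrow> plane) \<Rightarrow> distr" where
  "distr_div F \<phi> = - (LINT x|lborel. F x \<bullet> gradient \<phi> x)"

section \<open>Lebesgue spaces\<close>

text \<open>Elements of \<open>L\<^sup>p\<close> are given by Borel representatives.\<close>

definition Lp :: "real \<Rightarrow> (plane \<Rightarrow> real) set" where
  "Lp p = {g \<in> borel_measurable lborel. integrable lborel (\<lambda>x. \<bar>g x\<bar> powr p)}"

text \<open>Meaningful only for functions in \<^term>\<open>Lp p\<close>.\<close>

definition Lp_norm :: "real \<Rightarrow> (plane \<Rightarrow> real) \<Rightarrow> real" where
  "Lp_norm p g = (LINT x|lborel. \<bar>g x\<bar> powr p) powr (1 / p)"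

definition represents :: "(plane \<Rightarrow> real) \<Rightarrow> distr \<Rightarrow> bool" where
  "represents g T \<longleftrightarrow> (\<forall>\<phi>\<in>schwartz. T \<phi> = distr_of g \<phi>)"

definition Lp_distr :: "real \<Rightarrow> distr set" where
  "Lp_distr p = {T. \<exists>g\<in>Lp p. represents g T}"

text \<open>The function, unique up to null sets, that a distribution in \<^term>\<open>Lp_distr p\<close>
  stands for.\<close>

definition Lp_fun :: "real \<Rightarrow> distr \<Rightarrow> plane \<Rightarrow> real" where
  "Lp_fun p T = (SOME g. g \<in> Lp p \<and> represents g T)"

definition Lp_distr_norm :: "real \<Rightarrow> distr \<Rightarrow> real" where
  "Lp_distr_norm p T = Lp_norm p (Lp_fun p T)"

section \<open>The heat semigroup and the space of initial data\<close>

definition heat_kernel :: "plane \<Rightarrow> real \<Rightarrow> real" where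
  "heat_kernel x t = 1 / (4 * pi * t) * exp (- (norm x)\<^sup>2 / (4 * t))"

text \<open>The convolution of a tempered distribution with a Schwartz function is a
  (smooth) function; this is its value at \<open>x\<close>, for \<open>t > 0\<close>.\<close>

definition heat :: "real \<Rightarrow> distr \<Rightarrow> plane \<Rightarrow> real" where
  "heat t T x = T (\<lambda>y. heat_kernel (x - y) t)"

definition BX :: "distr set" where
  "BX = {T \<in> tempered. (\<forall>t>0. heat t T \<in> Lp (4/3)) \<and>
     bdd_above ((\<lambda>t. t powr (1/4) * Lp_norm (4/3) (heat t T)) ` {0<..})}"

definition BX_norm :: "distr \<Rightarrow> real" where
  "BX_norm T = (SUP t\<in>{0<..}. t powr (1/4) * Lp_norm (4/3) (heat t T))"

definition BX_open :: "distr set \<Rightarrow> bool" where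
  "BX_open U \<longleftrightarrow> U \<subseteq> BX \<and> (\<forall>T\<in>U. \<exists>r>0. \<forall>T'\<in>BX. BX_norm (T' - T) < r \<longrightarrow> T' \<in> U)"

definition BX_borel :: "distr measure" where
  "BX_borel = sigma BX (Collect BX_open)"

section \<open>Mild solutions of the Debye system\<close>

text \<open>\<open>\<nabla>\<phi>\<^sub>g = - (\<nabla>E\<^sub>2) * g\<close>.  The integral converges absolutely for almost every \<open>x\<close> if
  \<open>g\<close> is in \<^term>\<open>Lp (4/3)\<close>.\<close>

definition grad_potential :: "(plane \<Rightarrow> real) \<Rightarrow> plane \<Rightarrow> plane" where
  "grad_potential g x =
     - (1 / (2 * pi)) *\<^sub>R (LINT y|lborel. (g y / (norm (x - y))\<^sup>2) *\<^sub>R (x - y))"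

definition drift :: "(plane \<Rightarrow> real) \<Rightarrow> plane \<Rightarrow> plane" where
  "drift g x = g x *\<^sub>R grad_potential g x"

text \<open>The integrand \<open>S(t - \<tau>) \<nabla>\<cdot>(u \<nabla>\<phi>\<^sub>u)(\<tau>)\<close> of the Duhamel term.\<close>

definition duhamel_integrand :: "(real \<Rightarrow> distr) \<Rightarrow> real \<Rightarrow> real \<Rightarrow> distr" where
  "duhamel_integrand u t \<tau> =
     distr_of (heat (t - \<tau>) (distr_div (drift (Lp_fun (4/3) (u \<tau>)))))"

text \<open>The mild formulation as an identity between tempered distributions, the time integral
  being taken after pairing with a test function.\<close>

definition mild_solution :: "distr \<Rightarrow> (real \<Rightarrow> distr) \<Rightarrow> bool" where
  "mild_solution u0 u \<longleftrightarrow> (\<forall>t>0. \<forall>\<phi>\<in>schwartz.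
     set_integrable lebesgue {0<..<t} (\<lambda>\<tau>. duhamel_integrand u t \<tau> \<phi>) \<and>
     u t \<phi> = distr_of (heat t u0) \<phi>
            + (LINT \<tau>:{0<..<t}|lebesgue. duhamel_integrand u t \<tau> \<phi>))"

text \<open>Functions on \<open>[0,\<infinity>)\<close> are total functions whose values at negative times are ignored.\<close>

definition X_space :: "distr \<Rightarrow> (real \<Rightarrow> distr) set" where
  "X_space u0 = {f.
     f \<in> measurable (lebesgue_on {0..}) BX_borel \<and>
     (\<exists>C. AE t in lebesgue_on {0..}. BX_norm (f t) \<le> C) \<and>
     (\<forall>\<phi>\<in>schwartz. ((\<lambda>t. f t \<phi>) \<longlongrightarrow> u0 \<phi>) (at_right 0)) \<and>
     (\<forall>t>0. f t \<in> Lp_distr (4/3)) \<and>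
     bdd_above ((\<lambda>t. t powr (1/4) * Lp_distr_norm (4/3) (f t)) ` {0<..})}"

definition small_mild_solution :: "real \<Rightarrow> distr \<Rightarrow> (real \<Rightarrow> distr) \<Rightarrow> bool" where
  "small_mild_solution \<epsilon> u0 u \<longleftrightarrow>
     u \<in> X_space u0 \<and> mild_solution u0 u \<and>
     (SUP t\<in>{0<..}. t powr (1/4) * Lp_distr_norm (4/3) (u t)) < 2 * \<epsilon>"

end

theory Submission
  imports Defs
begin

text \<open>Put \<open>h t = t powr (1/4) * \<parallel>u t - v t\<parallel>\<close> and \<open>H t = t powr (1/4) * \<parallel>S t (u\<^sub>0 - v\<^sub>0)\<parallel>\<close>, with
  norms in \<open>L\<close> of exponent \<open>4/3\<close>.  By the Hardy--Littlewood--Sobolev inequality the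
  difference of the drifts at time \<open>\<tau>\<close> has \<open>L\<^sup>1\<close> norm at most
  \<open>C * \<epsilon> * \<tau> powr (-1/2) * h \<tau>\<close>, and the gradient of the heat kernel at time \<open>s\<close> has norm
  \<open>C * s powr (-3/4)\<close>.  Subtracting the Duhamel formulas gives
  \<open>\<bar>h t - H t\<bar> \<le> C * \<epsilon> * t powr (1/4) * \<integral>\<^sub>0\<^sup>t (t - \<tau>) powr (-3/4) * \<tau> powr (-1/2) * h \<tau> d\<tau>\<close>.
  The contribution of bounded times \<open>\<tau>\<close> vanishes as \<open>t\<close> tends to infinity, so that the upper limit of
  \<open>\<bar>h - H\<bar>\<close> is at most half of that of \<open>h\<close> for small \<open>\<epsilon>\<close>.  The mild equation is only known
  against test functions; the norms are recovered by duality with Schwartz functions, which are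
  dense in \<open>L\<^sup>4\<close>.\<close>

section \<open>Bounds in Lebesgue spaces\<close>

text \<open>The drift is quadratic, so the drifts of two small solutions differ by a small multiple
  of the difference of the solutions; this smallness is what gives the factor one half. Only one
  case of Hardy--Littlewood--Sobolev occurs, both functions in L^(4/3) of the plane against the
  kernel 1/|x - y|. It has an elementary proof: split the double integral by which of the two
  function values is larger. The integral of \<open>h\<close> over time is never formed, which
  sidesteps its measurability. Under the integral \<open>h\<close> is replaced by a function with
  two values: the crude bound \<open>4 * \<epsilon>\<close> up to a time \<open>T\<close>, and a
  bound \<open>L\<close> valid after \<open>T\<close>. Accordingly no upper limit is taken;
  \<open>L\<close> is improved repeatedly by the factor 3/4. Since the time integral exists only
  after pairing with a test function, the estimates of the heat flow are estimates of pairings,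
  uniform over test functions with a given L^4 bound. Norms mostly enter as upper bounds:
  \<open>Lp_le\<close> bundles measurability with a bound of an extended integral, so that
  monotonicity and Tonelli apply before integrability is known.\<close>

definition Lp_le :: "'a measure \<Rightarrow> real \<Rightarrow> ('a \<Rightarrow> real) \<Rightarrow> real \<Rightarrow> bool" where
  "Lp_le M p f a \<longleftrightarrow> f \<in> borel_measurable M \<and>
     (\<integral>\<^sup>+x. ennreal (\<bar>f x\<bar> powr p) \<partial>M) \<le> ennreal (a powr p)"

lemma Lp_le_scale:
  assumes "Lp_le M p f a" "0 \<le> a"
  shows "Lp_le M p (\<lambda>x. c * f x) (\<bar>c\<bar> * a)"
proof -
  have [measurable]: "f \<in> borel_measurable M" using assms by (simp add: Lp_le_def)
  have "(\<integral>\<^sup>+x. ennreal (\<bar>c * f x\<bar> powr p) \<partial>M)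
      = (\<integral>\<^sup>+x. ennreal (\<bar>c\<bar> powr p) * ennreal (\<bar>f x\<bar> powr p) \<partial>M)"
    by (intro nn_integral_cong) (simp add: abs_mult powr_mult ennreal_mult)
  also have "\<dots> = ennreal (\<bar>c\<bar> powr p) * (\<integral>\<^sup>+x. ennreal (\<bar>f x\<bar> powr p) \<partial>M)"
    by (rule nn_integral_cmult) measurable
  also have "\<dots> \<le> ennreal (\<bar>c\<bar> powr p) * ennreal (a powr p)"
    using assms by (intro mult_left_mono) (auto simp: Lp_le_def)
  also have "\<dots> = ennreal ((\<bar>c\<bar> * a) powr p)"
    using assms by (simp add: powr_mult ennreal_mult)
  finally show ?thesis by (simp add: Lp_le_def)
qed

text \<open>The inequalities below are first proved for functions with bound 1 and then rescaled.
  This division is why the bounds are assumed positive, not merely nonnegative.\<close>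

lemma Lp_le_normalize:
  assumes "Lp_le M p f a" "0 < a"
  shows "Lp_le M p (\<lambda>x. f x / a) 1"
  using Lp_le_scale[OF assms(1), of "1/a"] assms by simp

lemma Lp_le_unit: "Lp_le M p f 1 \<Longrightarrow> (\<integral>\<^sup>+x. ennreal (\<bar>f x\<bar> powr p) \<partial>M) \<le> 1"
  by (simp add: Lp_le_def)

lemma Lp_le_zero: "Lp_le M p (\<lambda>x. 0) a"
  by (simp add: Lp_le_def)

lemma Lp_le_uminus: "Lp_le M p (\<lambda>x. - f x) a \<longleftrightarrow> Lp_le M p f a"
proof -
  have "(\<lambda>x. - f x) \<in> borel_measurable M \<longleftrightarrow> f \<in> borel_measurable M"
    using borel_measurable_uminus[of "\<lambda>x. - f x" M] by auto
  then show ?thesis by (simp add: Lp_le_def)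
qed

text \<open>Young's inequality is applied pointwise to \<open>f x / a\<close> and
  \<open>g x / b\<close>. Both power integrals are then at most 1, and the weights 1/p and 1/q add
  up to 1.\<close>

lemma Holder_nn_integral:
  fixes f g :: "'a \<Rightarrow> real"
  assumes f: "Lp_le M p f a" and g: "Lp_le M q g b" and a: "0 < a" and b: "0 < b"
    and pq: "1 < p" "1 < q" "1 / p + 1 / q = 1"
  shows "(\<integral>\<^sup>+x. ennreal (\<bar>f x\<bar> * \<bar>g x\<bar>) \<partial>M) \<le> ennreal (a * b)"
proof -
  have [measurable]: "f \<in> borel_measurable M" "g \<in> borel_measurable M"
    using f g by (auto simp: Lp_le_def)
  have young: "\<bar>f x\<bar> * \<bar>g x\<bar> \<le> a * b * ((1 / p) * \<bar>f x / a\<bar> powr p + (1 / q) * \<bar>g x / b\<bar> powr q)" for x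
  proof -
    have "\<bar>f x / a\<bar> * \<bar>g x / b\<bar> \<le> \<bar>f x / a\<bar> powr p / p + \<bar>g x / b\<bar> powr q / q"
      by (rule Youngs_inequality) (use pq in auto)
    then have "a * b * (\<bar>f x / a\<bar> * \<bar>g x / b\<bar>) \<le> a * b * (\<bar>f x / a\<bar> powr p / p + \<bar>g x / b\<bar> powr q / q)"
      using a b by (intro mult_left_mono) auto
    then show ?thesis using a b by (simp add: field_simps abs_mult)
  qed
  have "(\<integral>\<^sup>+x. ennreal (\<bar>f x\<bar> * \<bar>g x\<bar>) \<partial>M)
     \<le> (\<integral>\<^sup>+x. ennreal (a * b) * (ennreal (1 / p) * ennreal (\<bar>f x / a\<bar> powr p)
          + ennreal (1 / q) * ennreal (\<bar>g x / b\<bar> powr q)) \<partial>M)"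
  proof (rule nn_integral_mono)
    fix x
    have "ennreal (\<bar>f x\<bar> * \<bar>g x\<bar>)
       \<le> ennreal (a * b * ((1 / p) * \<bar>f x / a\<bar> powr p + (1 / q) * \<bar>g x / b\<bar> powr q))"
      by (rule ennreal_leI[OF young])
    also have "\<dots> = ennreal (a * b) * (ennreal (1 / p) * ennreal (\<bar>f x / a\<bar> powr p)
          + ennreal (1 / q) * ennreal (\<bar>g x / b\<bar> powr q))"
      using a b pq by (simp add: ennreal_mult'[symmetric] ennreal_plus[symmetric] del: ennreal_plus abs_divide)
    finally show "ennreal (\<bar>f x\<bar> * \<bar>g x\<bar>) \<le> ennreal (a * b) * (ennreal (1 / p) * ennreal (\<bar>f x / a\<bar> powr p)
          + ennreal (1 / q) * ennreal (\<bar>g x / b\<bar> powr q))" .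
  qed
  also have "\<dots> = ennreal (a * b) * (ennreal (1 / p) * (\<integral>\<^sup>+x. ennreal (\<bar>f x / a\<bar> powr p) \<partial>M)
          + ennreal (1 / q) * (\<integral>\<^sup>+x. ennreal (\<bar>g x / b\<bar> powr q) \<partial>M))"
    by (simp add: nn_integral_cmult nn_integral_add del: abs_divide)
  also have "\<dots> \<le> ennreal (a * b) * (ennreal (1 / p) * 1 + ennreal (1 / q) * 1)"
    using Lp_le_unit[OF Lp_le_normalize[OF f a]] Lp_le_unit[OF Lp_le_normalize[OF g b]]
    by (intro mult_left_mono add_mono) auto
  also have "ennreal (1 / p) * 1 + ennreal (1 / q) * 1 = ennreal 1"
    using pq by (simp flip: ennreal_plus)
  finally show ?thesis by simp
qed

text \<open>Minkowski's inequality by convexity: (|f| + |g|)/(a + b) is the convex combination of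
  |f|/a and |g|/b with weights a/(a + b) and b/(a + b), so its p-th power is at most the same
  combination of the p-th powers, each of integral at most 1.\<close>

lemma Lp_le_add:
  fixes f g :: "'a \<Rightarrow> real"
  assumes f: "Lp_le M p f a" and g: "Lp_le M p g b" and a: "0 < a" and b: "0 < b" and p: "1 \<le> p"
  shows "Lp_le M p (\<lambda>x. f x + g x) (a + b)"
proof -
  have [measurable]: "f \<in> borel_measurable M" "g \<in> borel_measurable M"
    using f g by (auto simp: Lp_le_def)
  define s where "s = a / (a + b)"
  have s: "0 < s" "s < 1" "1 - s = b / (a + b)"
    using a b by (auto simp: s_def field_simps)
  have conv: "(s * u + (1 - s) * v) powr p \<le> s * u powr p + (1 - s) * v powr p"
    if uv: "0 \<le> u" "0 \<le> v" for u v
  proof -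
    \<comment> \<open>Convexity is applied at positive points only. If one of the numbers is 0, the
      claim reduces to the fact that the p-th power of a weight in (0,1) does not exceed the
      weight.\<close>
    consider "u = 0" | "v = 0" | "0 < u" "0 < v" using uv by fastforce
    then show ?thesis
    proof cases
      case 1
      have "(1 - s) powr p \<le> (1 - s) powr 1" using s p by (intro powr_mono') auto
      then show ?thesis using 1 p s(1,2) uv by (auto simp: powr_mult mult_right_mono)
    next
      case 2
      have "s powr p \<le> s powr 1" using s p by (intro powr_mono') auto
      then show ?thesis using 2 p s(1,2) uv by (auto simp: powr_mult mult_right_mono)
    next
      case 3
      have "((1 - (1 - s)) *\<^sub>R u + (1 - s) *\<^sub>R v) powr p \<le> (1 - (1 - s)) * u powr p + (1 - s) * v powr p"
        by (rule convex_onD[OF powr_convex[OF p]]) (use s 3 in auto)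
      then show ?thesis by simp
    qed
  qed
  have pw: "\<bar>f x + g x\<bar> powr p
      \<le> (a + b) powr p * (s * \<bar>f x / a\<bar> powr p + (1 - s) * \<bar>g x / b\<bar> powr p)" for x
  proof -
    have "(a + b) * (s * \<bar>f x / a\<bar> + (1 - s) * \<bar>g x / b\<bar>) = \<bar>f x\<bar> + \<bar>g x\<bar>"
    proof -
      have "s * \<bar>f x / a\<bar> = \<bar>f x\<bar> / (a + b)" "(1 - s) * \<bar>g x / b\<bar> = \<bar>g x\<bar> / (a + b)"
        using a b unfolding s(3) by (auto simp: s_def)
      then show ?thesis using a b by (simp add: distrib_left)
    qed
    then have "\<bar>f x + g x\<bar> powr p \<le> ((a + b) * (s * \<bar>f x / a\<bar> + (1 - s) * \<bar>g x / b\<bar>)) powr p"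
      using p by (intro powr_mono2) auto
    also have "\<dots> = (a + b) powr p * (s * \<bar>f x / a\<bar> + (1 - s) * \<bar>g x / b\<bar>) powr p"
      using a b s by (intro powr_mult)
    also have "\<dots> \<le> (a + b) powr p * (s * \<bar>f x / a\<bar> powr p + (1 - s) * \<bar>g x / b\<bar> powr p)"
      by (intro mult_left_mono conv) auto
    finally show ?thesis .
  qed
  have "(\<integral>\<^sup>+x. ennreal (\<bar>f x + g x\<bar> powr p) \<partial>M)
     \<le> (\<integral>\<^sup>+x. ennreal ((a + b) powr p) * (ennreal s * ennreal (\<bar>f x / a\<bar> powr p)
          + ennreal (1 - s) * ennreal (\<bar>g x / b\<bar> powr p)) \<partial>M)"
  proof (rule nn_integral_mono)
    fix x
    have "ennreal (\<bar>f x + g x\<bar> powr p)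
       \<le> ennreal ((a + b) powr p * (s * \<bar>f x / a\<bar> powr p + (1 - s) * \<bar>g x / b\<bar> powr p))"
      by (rule ennreal_leI[OF pw])
    also have "\<dots> = ennreal ((a + b) powr p) * (ennreal s * ennreal (\<bar>f x / a\<bar> powr p)
          + ennreal (1 - s) * ennreal (\<bar>g x / b\<bar> powr p))"
      using s(1,2) by (simp add: ennreal_mult'[symmetric] ennreal_plus[symmetric] del: ennreal_plus abs_divide)
    finally show "ennreal (\<bar>f x + g x\<bar> powr p) \<le> ennreal ((a + b) powr p) *
       (ennreal s * ennreal (\<bar>f x / a\<bar> powr p) + ennreal (1 - s) * ennreal (\<bar>g x / b\<bar> powr p))" .
  qed
  also have "\<dots> = ennreal ((a + b) powr p) * (ennreal s * (\<integral>\<^sup>+x. ennreal (\<bar>f x / a\<bar> powr p) \<partial>M)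
          + ennreal (1 - s) * (\<integral>\<^sup>+x. ennreal (\<bar>g x / b\<bar> powr p) \<partial>M))"
    by (simp add: nn_integral_cmult nn_integral_add del: abs_divide)
  also have "\<dots> \<le> ennreal ((a + b) powr p) * (ennreal s * 1 + ennreal (1 - s) * 1)"
    using Lp_le_unit[OF Lp_le_normalize[OF f a]] Lp_le_unit[OF Lp_le_normalize[OF g b]]
    by (intro mult_left_mono add_mono) auto
  also have "ennreal s * 1 + ennreal (1 - s) * 1 = ennreal 1"
    using s(1,2) by (simp flip: ennreal_plus)
  finally show ?thesis by (simp add: Lp_le_def)
qed

lemma Lp_le_diff:
  fixes f g :: "'a \<Rightarrow> real"
  assumes "Lp_le M p f a" "Lp_le M p g b" "0 < a" "0 < b" "1 \<le> p"
  shows "Lp_le M p (\<lambda>x. f x - g x) (a + b)"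
  using Lp_le_add[of M p f a "\<lambda>x. - g x" b] assms by (simp add: Lp_le_uminus)

lemma Holder_integrable:
  fixes f g :: "'a \<Rightarrow> real"
  assumes f: "Lp_le M p f a" and g: "Lp_le M q g b" and "0 < a" "0 < b"
    and pq: "1 < p" "1 < q" "1 / p + 1 / q = 1"
  shows "integrable M (\<lambda>x. f x * g x)" "\<bar>LINT x|M. f x * g x\<bar> \<le> a * b"
proof -
  have [measurable]: "f \<in> borel_measurable M" "g \<in> borel_measurable M"
    using f g by (auto simp: Lp_le_def)
  have le: "(\<integral>\<^sup>+x. ennreal (norm (f x * g x)) \<partial>M) \<le> ennreal (a * b)"
    using Holder_nn_integral[OF assms] by (simp add: abs_mult)
  show int: "integrable M (\<lambda>x. f x * g x)"
    by (rule integrableI_bounded) (use le in \<open>auto simp: less_top[symmetric] top_unique\<close>)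
  have "ennreal (norm (LINT x|M. f x * g x)) \<le> ennreal (a * b)"
    using integral_norm_bound_ennreal[OF int] le by (rule order_trans)
  then show "\<bar>LINT x|M. f x * g x\<bar> \<le> a * b"
    using assms by (simp add: ennreal_le_iff)
qed

lemma Lp_le_of_Lp:
  assumes "f \<in> Lp p" "Lp_norm p f \<le> a" "0 < p"
  shows "Lp_le lborel p f a"
proof -
  have i: "integrable lborel (\<lambda>x. \<bar>f x\<bar> powr p)" and m: "f \<in> borel_measurable lborel"
    using assms by (auto simp: Lp_def)
  have "(LINT x|lborel. \<bar>f x\<bar> powr p) = Lp_norm p f powr p"
    using assms by (simp add: Lp_norm_def powr_powr)
  also have "\<dots> \<le> a powr p"
    using assms by (intro powr_mono2) (auto simp: Lp_norm_def)
  finally show ?thesis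
    using i m by (simp add: Lp_le_def nn_integral_eq_integral ennreal_leI)
qed

lemma Lp_of_Lp_le:
  assumes "Lp_le lborel p f a" "0 \<le> a" "0 < p"
  shows "f \<in> Lp p" "Lp_norm p f \<le> a"
proof -
  have [measurable]: "f \<in> borel_measurable lborel" using assms by (simp add: Lp_le_def)
  have le: "(\<integral>\<^sup>+x. ennreal (\<bar>f x\<bar> powr p) \<partial>lborel) \<le> ennreal (a powr p)"
    using assms by (simp add: Lp_le_def)
  have i: "integrable lborel (\<lambda>x. \<bar>f x\<bar> powr p)"
    by (rule integrableI_bounded) (use le in \<open>auto simp: less_top[symmetric] top_unique\<close>)
  then show "f \<in> Lp p" by (auto simp: Lp_def)
  have "(LINT x|lborel. \<bar>f x\<bar> powr p) \<le> a powr p"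
    using le i by (simp add: nn_integral_eq_integral)
  then have "Lp_norm p f \<le> (a powr p) powr (1 / p)"
    unfolding Lp_norm_def using assms by (intro powr_mono2) auto
  then show "Lp_norm p f \<le> a" using assms by (simp add: powr_powr)
qed

lemma Lp_norm_nonneg: "0 \<le> Lp_norm p f"
  by (simp add: Lp_norm_def)

section \<open>Negative powers of the distance, integrated over a disc and over its
  complement\<close>

lemma ennreal_geometric_sum:
  assumes "0 \<le> c" "0 \<le> r" "r < 1"
  shows "(\<Sum>k. ennreal (c * r ^ k)) = ennreal (c / (1 - r))"
proof -
  have "(\<lambda>k. c * r ^ k) sums (c * (1 / (1 - r)))"
    using assms by (intro sums_mult geometric_sums) auto
  then show ?thesis
    using assms by (subst suminf_ennreal2) (auto simp: sums_iff)
qed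

lemma emeasure_ball_plane: "0 \<le> r \<Longrightarrow> emeasure lborel (ball (c::plane) r) = ennreal (pi * r\<^sup>2)"
  by (simp add: emeasure_ball unit_ball_vol_2)

text \<open>Dyadic decomposition in place of polar coordinates: on the annulus between the radii
  R/2^(k+1) and R/2^k the integrand is at most 2^(k+1)/R. Enlarging each annulus to a disc costs
  only a constant, since the terms form a geometric series with ratio 1/2.\<close>

lemma nn_integral_inverse_norm_ball:
  fixes y :: plane
  assumes R: "0 < R"
  shows "(\<integral>\<^sup>+x. ennreal (1 / norm (x - y)) * indicator (ball y R) x \<partial>lborel) \<le> ennreal (4 * pi * R)"
proof -
  have "ennreal (1 / norm (x - y)) * indicator (ball y R) x
      \<le> (\<Sum>k. ennreal (2 ^ Suc k / R) * indicator (ball y (R / 2 ^ k)) x)" for x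
  proof (cases "x \<in> ball y R \<and> x \<noteq> y")
    case True
    define d where "d = norm (x - y)"
    have d: "0 < d" "d < R" using True by (auto simp: d_def dist_norm norm_minus_commute)
    obtain n0 where "R / d < 2 ^ n0" using real_arch_pow[of 2 "R / d"] by auto
    then have ex: "\<exists>n. R / d \<le> 2 ^ n" by (auto intro: less_imp_le)
    \<comment> \<open>Minimality puts \<open>x\<close> into one annulus: \<open>n\<close> is not 0
      because d < R, and its predecessor \<open>k\<close> satisfies R/2^(k+1) <= d < R/2^k. The
      centre is left to the trivial case, since there 1/0 = 0.\<close>
    define n where "n = (LEAST n. R / d \<le> 2 ^ n)"
    have n: "R / d \<le> 2 ^ n" unfolding n_def by (rule LeastI_ex[OF ex])
    have "n \<noteq> 0" using n d by (intro notI) (simp add: field_simps)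
    then obtain k where k: "n = Suc k" by (cases n) auto
    have "\<not> R / d \<le> 2 ^ k" using not_less_Least[of k "\<lambda>n. R / d \<le> 2 ^ n"] k by (simp add: n_def)
    then have "x \<in> ball y (R / 2 ^ k)"
      using d by (simp add: d_def dist_norm norm_minus_commute field_simps)
    moreover have "1 / d \<le> 2 ^ Suc k / R" using n k d R by (simp add: field_simps)
    ultimately have "ennreal (1 / norm (x - y)) * indicator (ball y R) x
        \<le> ennreal (2 ^ Suc k / R) * indicator (ball y (R / 2 ^ k)) x"
      using True by (auto simp: d_def intro!: ennreal_leI)
    also have "\<dots> = (\<Sum>j\<in>{k}. ennreal (2 ^ Suc j / R) * indicator (ball y (R / 2 ^ j)) x)"
      by (subst sum.insert) (simp_all only: sum.empty add_0_right finite.emptyI empty_iff not_False_eq_True)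
    also have "\<dots> \<le> (\<Sum>k. ennreal (2 ^ Suc k / R) * indicator (ball y (R / 2 ^ k)) x)"
      by (rule sum_le_suminf) auto
    finally show ?thesis .
  qed (auto simp: indicator_def)
  then have "(\<integral>\<^sup>+x. ennreal (1 / norm (x - y)) * indicator (ball y R) x \<partial>lborel)
     \<le> (\<integral>\<^sup>+x. (\<Sum>k. ennreal (2 ^ Suc k / R) * indicator (ball y (R / 2 ^ k)) x) \<partial>lborel)"
    by (intro nn_integral_mono)
  also have "\<dots> = (\<Sum>k. ennreal (2 ^ Suc k / R) * emeasure lborel (ball y (R / 2 ^ k)))"
    by (subst nn_integral_suminf,
        intro borel_measurable_times_ennreal borel_measurable_const borel_measurable_indicator)
      (auto simp: nn_integral_cmult_indicator simp del: power_Suc)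
  also have "\<dots> = (\<Sum>k. ennreal ((2 * pi * R) * (1 / 2) ^ k))"
  proof (intro suminf_cong)
    fix k
    have "2 ^ Suc k / R * (pi * (R / 2 ^ k)\<^sup>2) = (2 * pi * R) * (1 / 2) ^ k"
      using R by (simp add: power_divide power2_eq_square)
    then show "ennreal (2 ^ Suc k / R) * emeasure lborel (ball y (R / 2 ^ k)) = ennreal ((2 * pi * R) * (1 / 2) ^ k)"
      using R by (simp add: emeasure_ball_plane ennreal_mult'[symmetric])
  qed
  also have "\<dots> = ennreal (2 * pi * R / (1 - 1 / 2))"
    using R by (intro ennreal_geometric_sum) auto
  finally show ?thesis by (simp add: ac_simps)
qed

text \<open>The same decomposition with annuli growing outwards. The area grows like 4^k and the
  integrand falls like 16^(-k), so the series has ratio 1/4.\<close>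

lemma nn_integral_inverse_norm_outside:
  fixes y :: plane
  assumes R: "0 < R"
  shows "(\<integral>\<^sup>+x. ennreal (1 / norm (x - y) ^ 4) * indicator (- ball y R) x \<partial>lborel)
    \<le> ennreal (16 * pi / 3 / R\<^sup>2)"
proof -
  have "ennreal (1 / norm (x - y) ^ 4) * indicator (- ball y R) x
      \<le> (\<Sum>k. ennreal (1 / (R * 2 ^ k) ^ 4) * indicator (ball y (R * 2 ^ Suc k)) x)" for x
  proof (cases "x \<in> - ball y R")
    case True
    define d where "d = norm (x - y)"
    have d: "R \<le> d" using True by (auto simp: d_def dist_norm norm_minus_commute)
    obtain n0 where "d / R < 2 ^ n0" using real_arch_pow[of 2 "d / R"] by auto
    then have ex: "\<exists>n. d / R < 2 ^ n" by auto
    define n where "n = (LEAST n. d / R < 2 ^ n)"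
    have n: "d / R < 2 ^ n" unfolding n_def by (rule LeastI_ex[OF ex])
    have "n \<noteq> 0" using n d R by (intro notI) (simp add: field_simps)
    then obtain k where k: "n = Suc k" by (cases n) auto
    have "\<not> d / R < 2 ^ k" using not_less_Least[of k "\<lambda>n. d / R < 2 ^ n"] k by (simp add: n_def)
    then have le: "R * 2 ^ k \<le> d" using R by (simp add: field_simps)
    have "x \<in> ball y (R * 2 ^ Suc k)"
      using n k R by (simp add: d_def dist_norm norm_minus_commute field_simps)
    moreover have "1 / d ^ 4 \<le> 1 / (R * 2 ^ k) ^ 4"
      using le d R by (intro divide_left_mono power_mono) auto
    ultimately have "ennreal (1 / norm (x - y) ^ 4) * indicator (- ball y R) x
        \<le> ennreal (1 / (R * 2 ^ k) ^ 4) * indicator (ball y (R * 2 ^ Suc k)) x"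
      using True by (auto simp: d_def simp del: power_Suc intro!: ennreal_leI)
    also have "\<dots> = (\<Sum>j\<in>{k}. ennreal (1 / (R * 2 ^ j) ^ 4) * indicator (ball y (R * 2 ^ Suc j)) x)"
      by (subst sum.insert) (simp_all only: sum.empty add_0_right finite.emptyI empty_iff not_False_eq_True)
    also have "\<dots> \<le> (\<Sum>k. ennreal (1 / (R * 2 ^ k) ^ 4) * indicator (ball y (R * 2 ^ Suc k)) x)"
      by (rule sum_le_suminf) auto
    finally show ?thesis .
  qed (auto simp: indicator_def)
  then have "(\<integral>\<^sup>+x. ennreal (1 / norm (x - y) ^ 4) * indicator (- ball y R) x \<partial>lborel)
     \<le> (\<integral>\<^sup>+x. (\<Sum>k. ennreal (1 / (R * 2 ^ k) ^ 4) * indicator (ball y (R * 2 ^ Suc k)) x) \<partial>lborel)"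
    by (intro nn_integral_mono)
  also have "\<dots> = (\<Sum>k. ennreal (1 / (R * 2 ^ k) ^ 4) * emeasure lborel (ball y (R * 2 ^ Suc k)))"
    by (subst nn_integral_suminf,
        intro borel_measurable_times_ennreal borel_measurable_const borel_measurable_indicator)
      (auto simp: nn_integral_cmult_indicator simp del: power_Suc)
  also have "\<dots> = (\<Sum>k. ennreal ((4 * pi / R\<^sup>2) * (1 / 4) ^ k))"
  proof (intro suminf_cong)
    fix k
    have "(2::real) ^ k * 2 ^ k = 4 ^ k" by (simp flip: power_mult_distrib)
    then have "1 / (R * 2 ^ k) ^ 4 * (pi * (R * 2 ^ Suc k)\<^sup>2) = (4 * pi / R\<^sup>2) * (1 / 4) ^ k"
      using R by (simp add: power_divide field_simps power2_eq_square power4_eq_xxxx)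
    then show "ennreal (1 / (R * 2 ^ k) ^ 4) * emeasure lborel (ball y (R * 2 ^ Suc k))
        = ennreal ((4 * pi / R\<^sup>2) * (1 / 4) ^ k)"
      using R by (simp add: emeasure_ball_plane ennreal_mult'[symmetric])
  qed
  also have "\<dots> = ennreal (4 * pi / R\<^sup>2 / (1 - 1 / 4))"
    using R by (intro ennreal_geometric_sum) auto
  also have "4 * pi / R\<^sup>2 / (1 - 1 / 4) = 16 * pi / 3 / R\<^sup>2" by (simp add: field_simps)
  finally show ?thesis .
qed

section \<open>The Hardy--Littlewood--Sobolev inequality\<close>

text \<open>A common pattern for the functions whose Lebesgue norms are computed later: the weight
  used for almost everywhere finiteness, Schwartz functions, and the gradient of the heat kernel. In
  each case the relevant power is bounded near a point and decays with the fourth power of the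
  distance.\<close>

lemma nn_integral_decay_bound:
  fixes F :: "plane \<Rightarrow> real"
  assumes "0 < R" "0 \<le> A" "0 \<le> B"
    and "\<And>x. x \<in> ball y R \<Longrightarrow> F x \<le> A" and "\<And>x. x \<notin> ball y R \<Longrightarrow> F x \<le> B / norm (x - y) ^ 4"
  shows "(\<integral>\<^sup>+x. ennreal (F x) \<partial>lborel) \<le> ennreal (A * (pi * R\<^sup>2) + B * (16 * pi / 3 / R\<^sup>2))"
proof -
  have [measurable]: "ball y R \<in> sets borel" by simp
  have "(\<integral>\<^sup>+x. ennreal (F x) \<partial>lborel) \<le> (\<integral>\<^sup>+x. ennreal A * indicator (ball y R) x
      + ennreal B * (ennreal (1 / norm (x - y) ^ 4) * indicator (- ball y R) x) \<partial>lborel)"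
    using assms by (intro nn_integral_mono)
      (auto simp: indicator_def ennreal_mult'[symmetric] intro!: ennreal_leI split: if_splits)
  also have "\<dots> = ennreal A * emeasure lborel (ball y R)
      + ennreal B * (\<integral>\<^sup>+x. ennreal (1 / norm (x - y) ^ 4) * indicator (- ball y R) x \<partial>lborel)"
    by (simp add: nn_integral_add nn_integral_cmult nn_integral_cmult_indicator)
  also have "\<dots> \<le> ennreal A * ennreal (pi * R\<^sup>2) + ennreal B * ennreal (16 * pi / 3 / R\<^sup>2)"
    using assms nn_integral_inverse_norm_outside[of R y]
    by (intro add_mono mult_left_mono) (auto simp: emeasure_ball_plane)
  also have "\<dots> = ennreal (A * (pi * R\<^sup>2) + B * (16 * pi / 3 / R\<^sup>2))"
    using assms by (simp add: ennreal_mult'[symmetric] ennreal_plus[symmetric] del: ennreal_plus)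
  finally show ?thesis .
qed

text \<open>The sum of three contributions to the truncated potential: 4 pi from the disc, and from
  its complement 1 for the integral of |f|^(4/3) and 16 pi / 3 for the integral of the fourth power
  of the kernel.\<close>

definition hls_const :: real where
  "hls_const = 1 + 28 * pi / 3"

lemma hls_const_pos: "0 < hls_const"
  unfolding hls_const_def by (simp add: add_pos_pos)

text \<open>The radius \<open>b powr (-2/3)\<close> balances the two regions: inside the ball \<open>f\<close> is bounded by
  \<open>b\<close>, outside it is paired with the kernel, whose fourth power is integrable there.\<close>

lemma truncated_potential_bound:
  fixes f :: "plane \<Rightarrow> real"
  assumes f: "Lp_le lborel (4/3) f 1" and b: "0 \<le> b"
  shows "(\<integral>\<^sup>+x. ennreal (if \<bar>f x\<bar> \<le> b then b * \<bar>f x\<bar> / norm (x - y) else 0) \<partial>lborel)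
    \<le> ennreal (hls_const * b powr (4/3))"
proof (cases "b = 0")
  case True
  then show ?thesis by (simp cong: if_cong)
next
  case False
  with b have b: "0 < b" by simp
  have [measurable]: "f \<in> borel_measurable lborel" using f by (simp add: Lp_le_def)
  define R where "R = b powr (-2/3)"
  have [measurable]: "ball y R \<in> sets borel" by simp
  \<comment> \<open>\<open>S\<close> is the square root of the radius. It is the weight in Young's
    inequality with exponents 4/3 and 4 that makes both outer terms multiples of b^(4/3). It also
    turns every fractional power of \<open>b\<close> in the final computation into an integer
    power.\<close>
  define S where "S = b powr (-1/3)"
  have R: "0 < R" and S: "0 < S" using b by (auto simp: R_def S_def)
  have RS: "R = S\<^sup>2" using b by (simp add: R_def S_def powr_power)
  have bS: "b = 1 / S ^ 3" "b powr (4/3) = 1 / S ^ 4"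
    using b by (auto simp: S_def powr_power powr_minus field_simps simp flip: powr_add)
  have young: "b * \<bar>f x\<bar> / norm (x - y) \<le> (b / S) * (\<bar>f x\<bar> powr (4/3) + S ^ 4 / norm (x - y) ^ 4)" for x
  proof -
    have "\<bar>f x\<bar> * (S / norm (x - y)) \<le> \<bar>f x\<bar> powr (4/3) / (4/3) + (S / norm (x - y)) powr 4 / 4"
      by (rule Youngs_inequality) (use S in auto)
    also have "(S / norm (x - y)) powr 4 = (S / norm (x - y)) ^ 4"
      using S by (subst powr_numeral) auto
    also have "\<bar>f x\<bar> powr (4/3) / (4/3) + (S / norm (x - y)) ^ 4 / 4
        \<le> \<bar>f x\<bar> powr (4/3) + S ^ 4 / norm (x - y) ^ 4"
    proof -
      have "0 \<le> (S / norm (x - y)) ^ 4" using S by simp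
      then have "\<bar>f x\<bar> powr (4/3) / (4/3) + (S / norm (x - y)) ^ 4 / 4
          \<le> \<bar>f x\<bar> powr (4/3) + (S / norm (x - y)) ^ 4" by (intro add_mono) auto
      then show ?thesis by (simp only: power_divide)
    qed
    finally have "(b / S) * (\<bar>f x\<bar> * (S / norm (x - y))) \<le> (b / S) * (\<bar>f x\<bar> powr (4/3) + S ^ 4 / norm (x - y) ^ 4)"
      using b S by (intro mult_left_mono) auto
    then show ?thesis using S by simp
  qed
  have "(\<integral>\<^sup>+x. ennreal (if \<bar>f x\<bar> \<le> b then b * \<bar>f x\<bar> / norm (x - y) else 0) \<partial>lborel)
     \<le> (\<integral>\<^sup>+x. ennreal (b\<^sup>2) * (ennreal (1 / norm (x - y)) * indicator (ball y R) x)
          + ennreal (b / S) * (ennreal (\<bar>f x\<bar> powr (4/3)) + ennreal (S ^ 4) *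
              (ennreal (1 / norm (x - y) ^ 4) * indicator (- ball y R) x)) \<partial>lborel)"
  proof (rule nn_integral_mono)
    fix x
    show "ennreal (if \<bar>f x\<bar> \<le> b then b * \<bar>f x\<bar> / norm (x - y) else 0)
      \<le> ennreal (b\<^sup>2) * (ennreal (1 / norm (x - y)) * indicator (ball y R) x)
          + ennreal (b / S) * (ennreal (\<bar>f x\<bar> powr (4/3)) + ennreal (S ^ 4) *
              (ennreal (1 / norm (x - y) ^ 4) * indicator (- ball y R) x))"
    proof (cases "x \<in> ball y R")
      case True
      have "(if \<bar>f x\<bar> \<le> b then b * \<bar>f x\<bar> / norm (x - y) else 0) \<le> b\<^sup>2 * (1 / norm (x - y))"
        using b by (auto simp: power2_eq_square divide_right_mono mult_left_mono)
      then show ?thesis using True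
        by (intro add_increasing2) (auto simp: ennreal_mult'[symmetric] intro!: ennreal_leI)
    next
      case False
      have "(if \<bar>f x\<bar> \<le> b then b * \<bar>f x\<bar> / norm (x - y) else 0)
          \<le> (b / S) * (\<bar>f x\<bar> powr (4/3) + S ^ 4 * (1 / norm (x - y) ^ 4))"
        using young[of x] b S by auto
      then have "ennreal (if \<bar>f x\<bar> \<le> b then b * \<bar>f x\<bar> / norm (x - y) else 0)
         \<le> ennreal ((b / S) * (\<bar>f x\<bar> powr (4/3) + S ^ 4 * (1 / norm (x - y) ^ 4)))"
        by (rule ennreal_leI)
      also have "\<dots> = ennreal (b / S) * (ennreal (\<bar>f x\<bar> powr (4/3)) + ennreal (S ^ 4) *
              (ennreal (1 / norm (x - y) ^ 4)))"
        using b S by (simp add: ennreal_mult'[symmetric] ennreal_plus[symmetric] del: ennreal_plus)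
      finally show ?thesis using False by simp
    qed
  qed
  also have "\<dots> = ennreal (b\<^sup>2) * (\<integral>\<^sup>+x. ennreal (1 / norm (x - y)) * indicator (ball y R) x \<partial>lborel)
      + ennreal (b / S) * ((\<integral>\<^sup>+x. ennreal (\<bar>f x\<bar> powr (4/3)) \<partial>lborel) + ennreal (S ^ 4) *
          (\<integral>\<^sup>+x. ennreal (1 / norm (x - y) ^ 4) * indicator (- ball y R) x \<partial>lborel))"
    by (simp add: nn_integral_add nn_integral_cmult)
  also have "\<dots> \<le> ennreal (b\<^sup>2) * ennreal (4 * pi * R)
      + ennreal (b / S) * (ennreal 1 + ennreal (S ^ 4) * ennreal (16 * pi / 3 / R\<^sup>2))"
    using Lp_le_unit[OF f] nn_integral_inverse_norm_ball[OF R] nn_integral_inverse_norm_outside[OF R]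
    by (intro add_mono mult_left_mono) auto
  also have "\<dots> = ennreal (b\<^sup>2 * (4 * pi * R) + (b / S) * (1 + S ^ 4 * (16 * pi / 3 / R\<^sup>2)))"
    using b S R by (simp add: ennreal_mult'[symmetric] ennreal_plus[symmetric] del: ennreal_plus ennreal_1)
  also have "b\<^sup>2 * (4 * pi * R) + (b / S) * (1 + S ^ 4 * (16 * pi / 3 / R\<^sup>2)) = hls_const * b powr (4/3)"
    using S unfolding RS bS(2) hls_const_def unfolding bS(1) by (simp add: field_simps flip: power_mult) (simp add: power_numeral_reduce field_simps)
  finally show ?thesis .
qed

text \<open>Where |f x| <= |g y|, the truncated potential bound with b = |g y| controls the inner
  integral by a multiple of |g y|^(4/3), whose integral is at most 1. Where |f x| > |g y|, the roles
  are exchanged after an application of Tonelli. Each half contributes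
  \<open>hls_const\<close>.\<close>

lemma hls_normalized:
  fixes f g :: "plane \<Rightarrow> real"
  assumes f: "Lp_le lborel (4/3) f 1" and g: "Lp_le lborel (4/3) g 1"
  shows "(\<integral>\<^sup>+y. \<integral>\<^sup>+x. ennreal (\<bar>g y\<bar> * \<bar>f x\<bar> / norm (x - y)) \<partial>lborel \<partial>lborel) \<le> ennreal (2 * hls_const)"
proof -
  have [measurable]: "f \<in> borel_measurable borel" "g \<in> borel_measurable borel"
    using f g by (auto simp: Lp_le_def)
  define k where "k a b x y = ennreal (if \<bar>a\<bar> \<le> b then b * \<bar>a\<bar> / norm (x - y) else 0)"
    for a b :: real and x y :: plane
  have half: "(\<integral>\<^sup>+y. \<integral>\<^sup>+x. k (f x) \<bar>g y\<bar> x y \<partial>lborel \<partial>lborel) \<le> ennreal hls_const"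
    if f: "Lp_le lborel (4/3) f 1" and g: "Lp_le lborel (4/3) g 1" for f g
  proof -
    have [measurable]: "g \<in> borel_measurable borel" using g by (auto simp: Lp_le_def)
    have "(\<integral>\<^sup>+y. \<integral>\<^sup>+x. k (f x) \<bar>g y\<bar> x y \<partial>lborel \<partial>lborel)
      \<le> (\<integral>\<^sup>+y. ennreal hls_const * ennreal (\<bar>g y\<bar> powr (4/3)) \<partial>lborel)"
      using truncated_potential_bound[OF f] hls_const_pos unfolding k_def
      by (intro nn_integral_mono) (auto simp: ennreal_mult'[symmetric])
    also have "\<dots> = ennreal hls_const * (\<integral>\<^sup>+y. ennreal (\<bar>g y\<bar> powr (4/3)) \<partial>lborel)"
      by (simp add: nn_integral_cmult)
    also have "\<dots> \<le> ennreal hls_const * 1"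
      using Lp_le_unit[OF g] by (intro mult_left_mono) auto
    finally show ?thesis by simp
  qed
  have km [measurable]: "(\<lambda>(x, y). k (f x) \<bar>g y\<bar> x y) \<in> borel_measurable (lborel \<Otimes>\<^sub>M lborel)"
    "(\<lambda>(y, x). k (f x) \<bar>g y\<bar> x y) \<in> borel_measurable (lborel \<Otimes>\<^sub>M lborel)"
    "(\<lambda>(x, y). k (g y) \<bar>f x\<bar> y x) \<in> borel_measurable (lborel \<Otimes>\<^sub>M lborel)"
    "(\<lambda>(y, x). k (g y) \<bar>f x\<bar> y x) \<in> borel_measurable (lborel \<Otimes>\<^sub>M lborel)"
    unfolding k_def by measurable
  have "(\<integral>\<^sup>+y. \<integral>\<^sup>+x. ennreal (\<bar>g y\<bar> * \<bar>f x\<bar> / norm (x - y)) \<partial>lborel \<partial>lborel)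
    \<le> (\<integral>\<^sup>+y. \<integral>\<^sup>+x. k (f x) \<bar>g y\<bar> x y + k (g y) \<bar>f x\<bar> y x \<partial>lborel \<partial>lborel)"
  proof (intro nn_integral_mono)
    fix x y :: plane
    show "ennreal (\<bar>g y\<bar> * \<bar>f x\<bar> / norm (x - y)) \<le> k (f x) \<bar>g y\<bar> x y + k (g y) \<bar>f x\<bar> y x"
      by (cases "\<bar>f x\<bar> \<le> \<bar>g y\<bar>") (auto simp: k_def mult.commute norm_minus_commute)
  qed
  also have "\<dots> = (\<integral>\<^sup>+y. (\<integral>\<^sup>+x. k (f x) \<bar>g y\<bar> x y \<partial>lborel) + (\<integral>\<^sup>+x. k (g y) \<bar>f x\<bar> y x \<partial>lborel) \<partial>lborel)"
    by (intro nn_integral_cong nn_integral_add) (auto simp: k_def)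
  also have "\<dots> = (\<integral>\<^sup>+y. \<integral>\<^sup>+x. k (f x) \<bar>g y\<bar> x y \<partial>lborel \<partial>lborel) + (\<integral>\<^sup>+y. \<integral>\<^sup>+x. k (g y) \<bar>f x\<bar> y x \<partial>lborel \<partial>lborel)"
    by (rule nn_integral_add) measurable
  also have "(\<integral>\<^sup>+y. \<integral>\<^sup>+x. k (g y) \<bar>f x\<bar> y x \<partial>lborel \<partial>lborel) = (\<integral>\<^sup>+x. \<integral>\<^sup>+y. k (g y) \<bar>f x\<bar> y x \<partial>lborel \<partial>lborel)"
    by (rule lborel_pair.Fubini') measurable
  also have "(\<integral>\<^sup>+y. \<integral>\<^sup>+x. k (f x) \<bar>g y\<bar> x y \<partial>lborel \<partial>lborel) + (\<integral>\<^sup>+x. \<integral>\<^sup>+y. k (g y) \<bar>f x\<bar> y x \<partial>lborel \<partial>lborel)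
     \<le> ennreal hls_const + ennreal hls_const"
    by (intro add_mono half f g)
  also have "\<dots> = ennreal (2 * hls_const)"
    using hls_const_pos by (simp flip: ennreal_plus)
  finally show ?thesis .
qed

text \<open>Up to a constant, the Riesz potential of order one of |f|. With values in
  \<open>ennreal\<close> it is defined everywhere and majorizes the gradient of the potential
  without any convergence assumption.\<close>

definition riesz :: "(plane \<Rightarrow> real) \<Rightarrow> plane \<Rightarrow> ennreal" where
  "riesz f x = (\<integral>\<^sup>+y. ennreal (\<bar>f y\<bar> / norm (x - y)) \<partial>lborel)"

lemma borel_measurable_riesz [measurable]:
  assumes [measurable]: "f \<in> borel_measurable borel"
  shows "riesz f \<in> borel_measurable borel"
proof -
  have "riesz f \<in> borel_measurable lborel" unfolding riesz_def by measurable
  then show ?thesis by simp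
qed

lemma hls:
  fixes f g :: "plane \<Rightarrow> real"
  assumes f: "Lp_le lborel (4/3) f a" and g: "Lp_le lborel (4/3) g b" and a: "0 < a" and b: "0 < b"
  shows "(\<integral>\<^sup>+x. ennreal \<bar>g x\<bar> * riesz f x \<partial>lborel) \<le> ennreal (2 * hls_const * a * b)"
proof -
  have [measurable]: "f \<in> borel_measurable borel" "g \<in> borel_measurable borel"
    using f g by (auto simp: Lp_le_def)
  have "(\<integral>\<^sup>+x. ennreal \<bar>g x\<bar> * riesz f x \<partial>lborel)
    = (\<integral>\<^sup>+x. \<integral>\<^sup>+y. ennreal (a * b) * ennreal (\<bar>g x / b\<bar> * \<bar>f y / a\<bar> / norm (y - x)) \<partial>lborel \<partial>lborel)"
    unfolding riesz_def
  proof (intro nn_integral_cong, subst nn_integral_cmult[symmetric])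
    fix x :: plane
    show "(\<integral>\<^sup>+y. ennreal \<bar>g x\<bar> * ennreal (\<bar>f y\<bar> / norm (x - y)) \<partial>lborel)
      = (\<integral>\<^sup>+y. ennreal (a * b) * ennreal (\<bar>g x / b\<bar> * \<bar>f y / a\<bar> / norm (y - x)) \<partial>lborel)"
      using a b by (intro nn_integral_cong) (auto simp: ennreal_mult'[symmetric] norm_minus_commute)
  qed measurable
  also have "\<dots> = ennreal (a * b) * (\<integral>\<^sup>+x. \<integral>\<^sup>+y. ennreal (\<bar>g x / b\<bar> * \<bar>f y / a\<bar> / norm (y - x)) \<partial>lborel \<partial>lborel)"
    by (simp add: nn_integral_cmult del: abs_divide)
  also have "\<dots> \<le> ennreal (a * b) * ennreal (2 * hls_const)"
    by (intro mult_left_mono hls_normalized Lp_le_normalize f g a b) auto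
  also have "\<dots> = ennreal (2 * hls_const * a * b)"
    using a b by (simp add: ennreal_mult'[symmetric] ac_simps)
  finally show ?thesis .
qed

text \<open>Hardy--Littlewood--Sobolev bounds only pairings, so the potential is paired with a
  strictly positive weight in L^(4/3). A finite integral forces a finite integrand almost
  everywhere, and positivity of the weight passes this on to the potential. Decay like |x|^(-3)
  suffices, since the power 4/3 turns it into |x|^(-4).\<close>

lemma riesz_finite_AE:
  assumes f: "Lp_le lborel (4/3) f a" and a: "0 < a"
  shows "AE x in lborel. riesz f x < \<infinity>"
proof -
  have [measurable]: "f \<in> borel_measurable borel" using f by (auto simp: Lp_le_def)
  define w :: "plane \<Rightarrow> real" where "w x = (if norm x < 1 then 1 else 1 / norm x ^ 3)" for x
  have wpos: "0 < w x" for x by (auto simp: w_def)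
  have [measurable]: "w \<in> borel_measurable borel" unfolding w_def by measurable
  define c where "c = pi + 16 * pi / 3"
  have c: "0 < c" by (simp add: c_def add_pos_pos)
  have "(\<integral>\<^sup>+x. ennreal (\<bar>w x\<bar> powr (4/3)) \<partial>lborel) \<le> ennreal (1 * (pi * 1\<^sup>2) + 1 * (16 * pi / 3 / 1\<^sup>2))"
  proof (rule nn_integral_decay_bound)
    fix x :: plane assume x: "x \<notin> ball 0 1"
    have "(norm x ^ 3) powr (4/3) = (norm x powr 3) powr (4/3)" by simp
    also have "\<dots> = norm x powr 4" by (simp only: powr_powr) simp
    also have "\<dots> = norm x ^ 4" by simp
    finally have "\<bar>w x\<bar> powr (4/3) = 1 / norm x ^ 4"
      using x by (auto simp: w_def powr_divide)
    then show "\<bar>w x\<bar> powr (4/3) \<le> 1 / norm (x - 0) ^ 4" by simp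
  qed (auto simp: w_def)
  then have w: "Lp_le lborel (4/3) w (c powr (3/4))"
    using c by (simp add: Lp_le_def powr_powr c_def)
  have "(\<integral>\<^sup>+x. ennreal \<bar>w x\<bar> * riesz f x \<partial>lborel) \<le> ennreal (2 * hls_const * a * c powr (3/4))"
    by (rule hls[OF f w a]) (use c in auto)
  then have "(\<integral>\<^sup>+x. ennreal \<bar>w x\<bar> * riesz f x \<partial>lborel) \<noteq> \<infinity>"
    by (auto simp: top_unique)
  then have "AE x in lborel. ennreal \<bar>w x\<bar> * riesz f x \<noteq> \<infinity>"
    by (intro nn_integral_noteq_infinite) measurable
  then show ?thesis
  proof eventually_elim
    case (elim x)
    then show ?case using wpos[of x] by (auto simp: ennreal_mult_eq_top_iff less_top)
  qed
qed

section \<open>The gradient of the potential and L^1 estimates of the drift\<close>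

lemma borel_measurable_grad_potential [measurable]:
  assumes [measurable]: "g \<in> borel_measurable borel"
  shows "grad_potential g \<in> borel_measurable borel"
proof -
  have "grad_potential g \<in> borel_measurable lborel" unfolding grad_potential_def by measurable
  then show ?thesis by simp
qed

lemma borel_measurable_drift [measurable]:
  assumes [measurable]: "g \<in> borel_measurable borel"
  shows "drift g \<in> borel_measurable borel"
  unfolding drift_def by measurable

lemma norm_riesz_kernel:
  fixes x y :: plane
  shows "norm ((c / (norm (x - y))\<^sup>2) *\<^sub>R (x - y)) = \<bar>c\<bar> / norm (x - y)"
  by (cases "x = y") (auto simp: power2_eq_square)

lemma integrable_riesz_kernel:
  assumes [measurable]: "g \<in> borel_measurable borel" and "riesz g x < \<infinity>"
  shows "integrable lborel (\<lambda>y. (g y / (norm (x - y))\<^sup>2) *\<^sub>R (x - y))"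
  by (rule integrableI_bounded) (use assms(2) in \<open>auto simp only: norm_riesz_kernel riesz_def[symmetric], measurable\<close>)

text \<open>The kernel of the gradient has norm 1/|x - y|, and the prefactor 1/(2 pi) is estimated
  by 1. Where the Riesz potential is infinite the inequality is trivial.\<close>

lemma norm_grad_potential_le:
  assumes g: "g \<in> borel_measurable borel"
  shows "ennreal (norm (grad_potential g x)) \<le> riesz g x"
proof (cases "riesz g x < \<infinity>")
  case True
  have "norm (grad_potential g x) \<le> norm (LINT y|lborel. (g y / (norm (x - y))\<^sup>2) *\<^sub>R (x - y))"
  proof -
    have "(1 / (2 * pi)) * norm (LINT y|lborel. (g y / (norm (x - y))\<^sup>2) *\<^sub>R (x - y))
        \<le> 1 * norm (LINT y|lborel. (g y / (norm (x - y))\<^sup>2) *\<^sub>R (x - y))"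
      using pi_gt3 by (intro mult_right_mono) auto
    then show ?thesis by (simp add: grad_potential_def)
  qed
  then have "ennreal (norm (grad_potential g x)) \<le> ennreal (norm (LINT y|lborel. (g y / (norm (x - y))\<^sup>2) *\<^sub>R (x - y)))"
    by (rule ennreal_leI)
  also have "\<dots> \<le> (\<integral>\<^sup>+y. ennreal (norm ((g y / (norm (x - y))\<^sup>2) *\<^sub>R (x - y))) \<partial>lborel)"
    by (rule integral_norm_bound_ennreal[OF integrable_riesz_kernel[OF g True]])
  also have "\<dots> = riesz g x" by (simp only: norm_riesz_kernel riesz_def)
  finally show ?thesis .
qed (simp add: not_less top_unique)

text \<open>Finiteness of both Riesz potentials is what makes the two integrals split: a divergent
  Bochner integral has the default value 0, and with it linearity could fail.\<close>

lemma grad_potential_diff: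
  assumes "f \<in> borel_measurable borel" "g \<in> borel_measurable borel" "riesz f x < \<infinity>" "riesz g x < \<infinity>"
  shows "grad_potential (\<lambda>y. f y - g y) x = grad_potential f x - grad_potential g x"
proof -
  have "(LINT y|lborel. ((f y - g y) / (norm (x - y))\<^sup>2) *\<^sub>R (x - y))
      = (LINT y|lborel. (f y / (norm (x - y))\<^sup>2) *\<^sub>R (x - y) - (g y / (norm (x - y))\<^sup>2) *\<^sub>R (x - y))"
    by (intro Bochner_Integration.integral_cong) (simp_all add: diff_divide_distrib scaleR_diff_left)
  also have "\<dots> = (LINT y|lborel. (f y / (norm (x - y))\<^sup>2) *\<^sub>R (x - y)) - (LINT y|lborel. (g y / (norm (x - y))\<^sup>2) *\<^sub>R (x - y))"
    by (intro Bochner_Integration.integral_diff integrable_riesz_kernel assms)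
  finally show ?thesis
    unfolding grad_potential_def by (simp only: scaleR_diff_right)
qed

lemma drift_bound:
  assumes u: "Lp_le lborel (4/3) u a" and a: "0 < a"
  shows "(\<integral>\<^sup>+x. ennreal (norm (drift u x)) \<partial>lborel) \<le> ennreal (2 * hls_const * a * a)"
proof -
  have "(\<integral>\<^sup>+x. ennreal (norm (drift u x)) \<partial>lborel) \<le> (\<integral>\<^sup>+x. ennreal \<bar>u x\<bar> * riesz u x \<partial>lborel)"
    using u by (intro nn_integral_mono)
      (auto simp: drift_def ennreal_mult' Lp_le_def intro!: mult_left_mono norm_grad_potential_le)
  also have "\<dots> \<le> ennreal (2 * hls_const * a * a)" by (rule hls[OF u u a a])
  finally show ?thesis .
qed

text \<open>The drift is bilinear in the density and its potential. With w = u - v the difference is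
  w times the gradient of the potential of u, plus v times the gradient of the potential of w. Each
  product contains \<open>w\<close> once and is bounded by \<open>hls\<close>.\<close>

lemma drift_diff_bound:
  assumes u: "Lp_le lborel (4/3) u a" and v: "Lp_le lborel (4/3) v a" and a: "0 < a"
    and w: "Lp_le lborel (4/3) (\<lambda>x. u x - v x) d" and d: "0 < d"
  shows "(\<integral>\<^sup>+x. ennreal (norm (drift u x - drift v x)) \<partial>lborel) \<le> ennreal (4 * hls_const * a * d)"
proof -
  have [measurable]: "u \<in> borel_measurable borel" "v \<in> borel_measurable borel"
    using u v by (auto simp: Lp_le_def)
  define w where "w x = u x - v x" for x
  have [measurable]: "w \<in> borel_measurable borel" unfolding w_def by measurable
  have w': "Lp_le lborel (4/3) w d" using w by (simp add: w_def[abs_def])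
  have "(\<integral>\<^sup>+x. ennreal (norm (drift u x - drift v x)) \<partial>lborel)
     \<le> (\<integral>\<^sup>+x. ennreal \<bar>w x\<bar> * riesz u x + ennreal \<bar>v x\<bar> * riesz w x \<partial>lborel)"
  proof (rule nn_integral_mono_AE)
    show "AE x in lborel. ennreal (norm (drift u x - drift v x))
       \<le> ennreal \<bar>w x\<bar> * riesz u x + ennreal \<bar>v x\<bar> * riesz w x"
      using riesz_finite_AE[OF u a] riesz_finite_AE[OF v a]
    proof eventually_elim
      case (elim x)
      have gw: "grad_potential w x = grad_potential u x - grad_potential v x"
        using elim grad_potential_diff[of u v x] by (simp add: w_def[abs_def])
      have "drift u x - drift v x = w x *\<^sub>R grad_potential u x + v x *\<^sub>R grad_potential w x"
        unfolding drift_def gw w_def by (simp add: algebra_simps)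
      then have "norm (drift u x - drift v x) \<le> \<bar>w x\<bar> * norm (grad_potential u x) + \<bar>v x\<bar> * norm (grad_potential w x)"
        using norm_triangle_ineq[of "w x *\<^sub>R grad_potential u x" "v x *\<^sub>R grad_potential w x"] by simp
      then have "ennreal (norm (drift u x - drift v x))
         \<le> ennreal (\<bar>w x\<bar> * norm (grad_potential u x) + \<bar>v x\<bar> * norm (grad_potential w x))"
        by (rule ennreal_leI)
      also have "\<dots> = ennreal \<bar>w x\<bar> * ennreal (norm (grad_potential u x))
          + ennreal \<bar>v x\<bar> * ennreal (norm (grad_potential w x))"
        by (simp add: ennreal_mult')
      also have "\<dots> \<le> ennreal \<bar>w x\<bar> * riesz u x + ennreal \<bar>v x\<bar> * riesz w x"
        by (intro add_mono mult_left_mono norm_grad_potential_le) auto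
      finally show ?case .
    qed
  qed
  also have "\<dots> = (\<integral>\<^sup>+x. ennreal \<bar>w x\<bar> * riesz u x \<partial>lborel) + (\<integral>\<^sup>+x. ennreal \<bar>v x\<bar> * riesz w x \<partial>lborel)"
    by (rule nn_integral_add) measurable
  also have "\<dots> \<le> ennreal (2 * hls_const * a * d) + ennreal (2 * hls_const * d * a)"
    by (intro add_mono hls u v w' a d)
  also have "\<dots> = ennreal (4 * hls_const * a * d)"
    using a d hls_const_pos by (simp add: ac_simps flip: ennreal_plus)
  finally show ?thesis .
qed

section \<open>Schwartz functions\<close>

text \<open>The induction carries along that the derivative in each fixed direction is again
  polynomial in the point; without this, partial derivatives could not be iterated.\<close>

lemma real_polynomial_function_has_derivative:
  fixes p :: "'a::real_normed_vector \<Rightarrow> real"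
  assumes "real_polynomial_function p"
  shows "\<exists>D. (\<forall>x. (p has_derivative D x) (at x)) \<and> (\<forall>v. real_polynomial_function (\<lambda>x. D x v))"
  using assms
proof induction
  case (linear f)
  then show ?case
    by (intro exI[of _ "\<lambda>x. f"]) (auto intro: bounded_linear_imp_has_derivative)
next
  case (const c)
  then show ?case by (intro exI[of _ "\<lambda>x v. 0"]) auto
next
  case (add f g)
  then obtain Df Dg where "\<forall>x. (f has_derivative Df x) (at x)" "\<forall>v. real_polynomial_function (\<lambda>x. Df x v)"
     "\<forall>x. (g has_derivative Dg x) (at x)" "\<forall>v. real_polynomial_function (\<lambda>x. Dg x v)" by blast
  then show ?case
    by (intro exI[of _ "\<lambda>x v. Df x v + Dg x v"]) (auto intro!: derivative_eq_intros)
next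
  case (mult f g)
  then obtain Df Dg where "\<forall>x. (f has_derivative Df x) (at x)" "\<forall>v. real_polynomial_function (\<lambda>x. Df x v)"
     "\<forall>x. (g has_derivative Dg x) (at x)" "\<forall>v. real_polynomial_function (\<lambda>x. Dg x v)" by blast
  with mult.hyps show ?case
    by (intro exI[of _ "\<lambda>x v. f x * Dg x v + Df x v * g x"] conjI allI
        real_polynomial_function.intros(3,4)) (auto intro!: derivative_eq_intros)
qed

lemma real_polynomial_function_growth:
  fixes p :: "'a::real_normed_vector \<Rightarrow> real"
  assumes "real_polynomial_function p"
  shows "\<exists>C n. 0 \<le> C \<and> (\<forall>x. \<bar>p x\<bar> \<le> C * (1 + norm x) ^ n)"
  using assms
proof induction
  case (linear f)
  then obtain K where K: "\<And>x. norm (f x) \<le> norm x * K" "0 \<le> K"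
    using bounded_linear.nonneg_bounded by blast
  have "\<bar>f x\<bar> \<le> K * (1 + norm x) ^ 1" for x
    using K(1)[of x] K(2) by (simp add: algebra_simps)
  then show ?case using K by blast
next
  case (const c)
  then show ?case by (intro exI[of _ "\<bar>c\<bar>"] exI[of _ 0]) auto
next
  case (add f g)
  then obtain C n D m where b: "0 \<le> C" "\<And>x. \<bar>f x\<bar> \<le> C * (1 + norm x) ^ n"
    "0 \<le> D" "\<And>x. \<bar>g x\<bar> \<le> D * (1 + norm x) ^ m" by blast
  have "\<bar>f x + g x\<bar> \<le> (C + D) * (1 + norm x) ^ (n + m)" for x
  proof -
    have "\<bar>f x\<bar> \<le> C * (1 + norm x) ^ (n + m)"
      by (rule order_trans[OF b(2)]) (intro mult_left_mono power_increasing b, auto)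
    moreover have "\<bar>g x\<bar> \<le> D * (1 + norm x) ^ (n + m)"
      by (rule order_trans[OF b(4)]) (intro mult_left_mono power_increasing b, auto)
    ultimately show ?thesis by (simp add: distrib_right)
  qed
  then show ?case using b by (meson add_nonneg_nonneg)
next
  case (mult f g)
  then obtain C n D m where b: "0 \<le> C" "\<And>x. \<bar>f x\<bar> \<le> C * (1 + norm x) ^ n"
    "0 \<le> D" "\<And>x. \<bar>g x\<bar> \<le> D * (1 + norm x) ^ m" by blast
  have "\<bar>f x * g x\<bar> \<le> (C * D) * (1 + norm x) ^ (n + m)" for x
  proof -
    have "\<bar>f x * g x\<bar> \<le> (C * (1 + norm x) ^ n) * (D * (1 + norm x) ^ m)"
      unfolding abs_mult using b by (intro mult_mono) auto
    then show ?thesis by (simp add: power_add ac_simps)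
  qed
  then show ?case using b by (meson mult_nonneg_nonneg)
qed

text \<open>Products of a polynomial with exp(-q), for a fixed polynomial \<open>q\<close>, are
  closed under partial derivatives: by the product rule only the polynomial factor changes. Iterated
  derivatives therefore never have to be computed explicitly.\<close>

lemma poly_exp_has_derivative:
  fixes P q :: "plane \<Rightarrow> real"
  assumes "real_polynomial_function P" "real_polynomial_function q"
  shows "\<exists>P'. real_polynomial_function P' \<and>
    (\<forall>x. (\<lambda>x. P x * exp (- q x)) differentiable (at x) \<and> partial i (\<lambda>x. P x * exp (- q x)) x = P' x * exp (- q x))"
proof -
  obtain DP Dq where D: "\<And>x. (P has_derivative DP x) (at x)" "\<And>v. real_polynomial_function (\<lambda>x. DP x v)"
     "\<And>x. (q has_derivative Dq x) (at x)" "\<And>v. real_polynomial_function (\<lambda>x. Dq x v)"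
    using real_polynomial_function_has_derivative assms by metis
  have d: "((\<lambda>x. P x * exp (- q x)) has_derivative (\<lambda>v. (DP x v - P x * Dq x v) * exp (- q x))) (at x)" for x
    by (auto intro!: derivative_eq_intros D simp: algebra_simps)
  show ?thesis
  proof (intro exI conjI allI)
    show "real_polynomial_function (\<lambda>x. DP x (axis i 1) - P x * Dq x (axis i 1))"
      by (intro real_polynomial_function_diff real_polynomial_function.intros(4) D assms)
    show "(\<lambda>x. P x * exp (- q x)) differentiable (at x)" for x
      using d by (auto simp: differentiable_def)
    show "partial i (\<lambda>x. P x * exp (- q x)) x = (DP x (axis i 1) - P x * Dq x (axis i 1)) * exp (- q x)" for x
      unfolding partial_def frechet_derivative_at[OF d, symmetric] by simp
  qed
qed

lemma iter_partial_poly_exp: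
  fixes P q :: "plane \<Rightarrow> real"
  assumes "real_polynomial_function P" "real_polynomial_function q"
  shows "\<exists>P'. real_polynomial_function P' \<and> iter_partial is (\<lambda>x. P x * exp (- q x)) = (\<lambda>x. P' x * exp (- q x))"
proof (induction "is")
  case Nil
  then show ?case using assms by auto
next
  case (Cons i "is")
  then obtain P' where P': "real_polynomial_function P'"
    "iter_partial is (\<lambda>x. P x * exp (- q x)) = (\<lambda>x. P' x * exp (- q x))" by blast
  with poly_exp_has_derivative[OF P'(1) assms(2), of i] show ?case by auto
qed

text \<open>Raise s <= exp s to the power \<open>n\<close> at s = c(1 + y)/n. The right side becomes
  exp(c(1 + y)), which cancels the decaying exponential up to the factor exp c.\<close>

lemma poly_exp_decay:
  fixes c :: real
  assumes c: "0 < c"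
  shows "\<exists>B. \<forall>y\<ge>0. (1 + y) ^ m * exp (- (c * y)) \<le> B"
proof (intro exI allI impI)
  fix y :: real assume y: "0 \<le> y"
  \<comment> \<open>The successor keeps \<open>n\<close> positive, so that dividing by n/c makes
    sense even for m = 0.\<close>
  define n where "n = Suc m"
  define e where "e = real n / c"
  have e: "0 < e" using c by (simp add: e_def n_def)
  have "((1 + y) / e) ^ n \<le> exp ((1 + y) / e) ^ n"
  proof (rule power_mono)
    show "(1 + y) / e \<le> exp ((1 + y) / e)" using exp_ge_add_one_self[of "(1 + y) / e"] by linarith
  qed (use e y in auto)
  also have "\<dots> = exp (c * (1 + y))"
  proof -
    have "real n * ((1 + y) / e) = c * (1 + y)" using c by (simp add: e_def n_def)
    then show ?thesis by (simp only: exp_of_nat_mult[symmetric])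
  qed
  finally have le: "(1 + y) ^ n \<le> e ^ n * exp (c * (1 + y))"
    using e by (simp add: power_divide field_simps)
  have "(1 + y) ^ m \<le> (1 + y) ^ n" using y by (intro power_increasing) (auto simp: n_def)
  with le have "(1 + y) ^ m * exp (- (c * y)) \<le> (e ^ n * exp (c * (1 + y))) * exp (- (c * y))"
    by (intro mult_right_mono) auto
  also have "\<dots> = e ^ n * exp c" by (simp add: distrib_left mult.assoc flip: exp_add)
  finally show "(1 + y) ^ m * exp (- (c * y)) \<le> (real (Suc m) / c) ^ Suc m * exp c"
    by (simp only: e_def n_def)
qed

text \<open>Every iterated derivative is a polynomial times exp(-q). Polynomials grow at most like a
  power of 1 + |x|, and linear growth of \<open>q\<close> already makes the exponential beat every
  power.\<close>

lemma schwartz_poly_exp: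
  fixes P q :: "plane \<Rightarrow> real"
  assumes P: "real_polynomial_function P" and q: "real_polynomial_function q"
    and c: "0 < c" and coercive: "\<And>x. c * norm x - d \<le> q x"
  shows "(\<lambda>x. P x * exp (- q x)) \<in> schwartz"
  unfolding schwartz_def mem_Collect_eq smooth_def
proof (intro conjI allI)
  fix "is" and x
  obtain P' where P': "real_polynomial_function P'"
    "iter_partial is (\<lambda>x. P x * exp (- q x)) = (\<lambda>x. P' x * exp (- q x))"
    using iter_partial_poly_exp[OF P q] by blast
  show "iter_partial is (\<lambda>x. P x * exp (- q x)) differentiable at x"
    using poly_exp_has_derivative[OF P'(1) q] P'(2) by auto
next
  fix k "is"
  obtain P' where P': "real_polynomial_function P'"
    "iter_partial is (\<lambda>x. P x * exp (- q x)) = (\<lambda>x. P' x * exp (- q x))"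
    using iter_partial_poly_exp[OF P q] by blast
  obtain C n where C: "0 \<le> C" "\<And>x. \<bar>P' x\<bar> \<le> C * (1 + norm x) ^ n"
    using real_polynomial_function_growth[OF P'(1)] by blast
  obtain B where B: "\<And>y. 0 \<le> y \<Longrightarrow> (1 + y) ^ (k + n) * exp (- (c * y)) \<le> B"
    using poly_exp_decay[OF c] by blast
  have "norm ((1 + norm x) ^ k * iter_partial is (\<lambda>x. P x * exp (- q x)) x) \<le> C * exp d * B" for x
  proof -
    have "norm ((1 + norm x) ^ k * iter_partial is (\<lambda>x. P x * exp (- q x)) x)
      = (1 + norm x) ^ k * \<bar>P' x\<bar> * exp (- q x)"
      by (simp add: P'(2) abs_mult)
    also have "\<dots> \<le> (1 + norm x) ^ k * (C * (1 + norm x) ^ n) * exp (- (c * norm x - d))"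
      using C coercive[of x] by (intro mult_mono mult_left_mono) auto
    also have "\<dots> = C * exp d * ((1 + norm x) ^ (k + n) * exp (- (c * norm x)))"
      by (simp add: power_add exp_diff exp_minus field_simps)
    also have "\<dots> \<le> C * exp d * B"
      using B C by (intro mult_left_mono) auto
    finally show ?thesis .
  qed
  then show "bounded (range (\<lambda>x. (1 + norm x) ^ k * iter_partial is (\<lambda>x. P x * exp (- q x)) x))"
    by (auto simp: bounded_iff)
qed

section \<open>Linear combinations of Schwartz functions, and their L^4 bounds\<close>

lemma iter_partial_linear:
  assumes "smooth \<phi>" "smooth \<psi>"
  shows "iter_partial is (\<lambda>x. a * \<phi> x + b * \<psi> x) = (\<lambda>x. a * iter_partial is \<phi> x + b * iter_partial is \<psi> x)"
proof (induction "is")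
  case (Cons i "is")
  have "partial i (\<lambda>x. a * iter_partial is \<phi> x + b * iter_partial is \<psi> x) x
     = a * partial i (iter_partial is \<phi>) x + b * partial i (iter_partial is \<psi>) x" for x
  proof -
    have d: "(iter_partial is \<phi> has_derivative frechet_derivative (iter_partial is \<phi>) (at x)) (at x)"
      "(iter_partial is \<psi> has_derivative frechet_derivative (iter_partial is \<psi>) (at x)) (at x)"
      using assms by (auto simp: smooth_def frechet_derivative_works[symmetric])
    have "((\<lambda>x. a * iter_partial is \<phi> x + b * iter_partial is \<psi> x) has_derivative
       (\<lambda>v. a * frechet_derivative (iter_partial is \<phi>) (at x) v + b * frechet_derivative (iter_partial is \<psi>) (at x) v)) (at x)"
      by (auto intro!: derivative_eq_intros d)
    from frechet_derivative_at[OF this, symmetric] show ?thesis by (simp add: partial_def)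
  qed
  with Cons show ?case by auto
qed simp

lemma schwartz_linear:
  assumes "\<phi> \<in> schwartz" "\<psi> \<in> schwartz"
  shows "(\<lambda>x. a * \<phi> x + b * \<psi> x) \<in> schwartz"
proof -
  have s: "smooth \<phi>" "smooth \<psi>" using assms by (auto simp: schwartz_def)
  show ?thesis
    unfolding schwartz_def mem_Collect_eq smooth_def iter_partial_linear[OF s]
  proof (intro conjI allI)
    fix "is" x
    show "(\<lambda>x. a * iter_partial is \<phi> x + b * iter_partial is \<psi> x) differentiable at x"
      using s by (auto simp: smooth_def intro!: differentiable_add differentiable_mult)
  next
    fix k "is"
    have "bounded (range (\<lambda>x. (1 + norm x) ^ k * iter_partial is \<phi> x))"
      "bounded (range (\<lambda>x. (1 + norm x) ^ k * iter_partial is \<psi> x))"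
      using assms by (auto simp: schwartz_def)
    then obtain A B where AB: "\<And>x. \<bar>(1 + norm x) ^ k * iter_partial is \<phi> x\<bar> \<le> A"
      "\<And>x. \<bar>(1 + norm x) ^ k * iter_partial is \<psi> x\<bar> \<le> B"
      by (auto simp: bounded_iff)
    have "norm ((1 + norm x) ^ k * (a * iter_partial is \<phi> x + b * iter_partial is \<psi> x)) \<le> \<bar>a\<bar> * A + \<bar>b\<bar> * B" for x
    proof -
      have "(1 + norm x) ^ k * (a * iter_partial is \<phi> x + b * iter_partial is \<psi> x)
        = a * ((1 + norm x) ^ k * iter_partial is \<phi> x) + b * ((1 + norm x) ^ k * iter_partial is \<psi> x)"
        by (simp add: algebra_simps)
      then have "norm ((1 + norm x) ^ k * (a * iter_partial is \<phi> x + b * iter_partial is \<psi> x))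
        \<le> \<bar>a\<bar> * \<bar>(1 + norm x) ^ k * iter_partial is \<phi> x\<bar> + \<bar>b\<bar> * \<bar>(1 + norm x) ^ k * iter_partial is \<psi> x\<bar>"
        by (simp only: real_norm_def) (metis abs_mult abs_triangle_ineq)
      also have "\<dots> \<le> \<bar>a\<bar> * A + \<bar>b\<bar> * B"
        by (intro add_mono mult_left_mono AB) auto
      finally show ?thesis .
    qed
    then show "bounded (range (\<lambda>x. (1 + norm x) ^ k * (a * iter_partial is \<phi> x + b * iter_partial is \<psi> x)))"
      by (auto simp: bounded_iff)
  qed
qed

lemma schwartz_zero: "(\<lambda>x. 0) \<in> schwartz"
proof -
  have "iter_partial is (\<lambda>x. 0) = (\<lambda>x. 0)" for "is"
    by (induction "is") (auto simp: partial_def)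
  then show ?thesis by (auto simp: schwartz_def smooth_def bounded_iff)
qed

lemma schwartz_continuous: "\<phi> \<in> schwartz \<Longrightarrow> continuous_on UNIV \<phi>"
  unfolding schwartz_def smooth_def mem_Collect_eq
  by (metis differentiable_imp_continuous_within continuous_at_imp_continuous_on iter_partial.simps(1))

lemma schwartz_measurable: "\<phi> \<in> schwartz \<Longrightarrow> \<phi> \<in> borel_measurable borel"
  by (intro borel_measurable_continuous_onI schwartz_continuous)

text \<open>A single seminorm is enough: boundedness of (1 + |x|) |phi| gives both the bound near
  the origin and the decay |x|^(-4) of the fourth power.\<close>

lemma schwartz_Lp_le_4:
  assumes "\<phi> \<in> schwartz"
  obtains b where "0 < b" "Lp_le lborel 4 \<phi> b"
proof -
  have "bounded (range (\<lambda>x. (1 + norm x) ^ 1 * iter_partial [] \<phi> x))"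
    using assms unfolding schwartz_def by blast
  then obtain B where B: "\<And>x. \<bar>(1 + norm x) * \<phi> x\<bar> \<le> B" by (auto simp: bounded_iff)
  have B0: "0 \<le> B" using B[of 0] by linarith
  have B1: "(1 + norm x) * \<bar>\<phi> x\<bar> \<le> B" for x using B[of x] by (simp add: abs_mult)
  have b1: "\<bar>\<phi> x\<bar> \<le> B" for x
    using B1[of x] by (simp add: algebra_simps) (smt (verit) mult_nonneg_nonneg norm_ge_zero)
  have b2: "norm x * \<bar>\<phi> x\<bar> \<le> B" for x
    using B1[of x] by (simp add: algebra_simps)
  have "(\<integral>\<^sup>+x. ennreal (\<bar>\<phi> x\<bar> powr 4) \<partial>lborel) \<le> ennreal (B ^ 4 * (pi * 1\<^sup>2) + B ^ 4 * (16 * pi / 3 / 1\<^sup>2))"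
  proof (rule nn_integral_decay_bound)
    fix x :: plane
    show "\<bar>\<phi> x\<bar> powr 4 \<le> B ^ 4" using power_mono[OF b1[of x], of 4] by simp
    assume "x \<notin> ball 0 1"
    then have "x \<noteq> 0" by auto
    then show "\<bar>\<phi> x\<bar> powr 4 \<le> B ^ 4 / norm (x - 0) ^ 4"
      using power_mono[OF b2[of x], of 4] by (simp add: power_mult_distrib field_simps)
  qed (use B0 in auto)
  \<comment> \<open>The integral is at most 19/3 pi B^4, hence at most 7 pi B^4. Adding 1 makes the
    bound positive and at least 1, so that it is dominated by its own fourth power and no root has
    to be taken.\<close>
  moreover have "B ^ 4 * (pi * 1\<^sup>2) + B ^ 4 * (16 * pi / 3 / 1\<^sup>2) \<le> (1 + B ^ 4 * 7 * pi) powr 4"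
  proof -
    have "B ^ 4 * (pi * 1\<^sup>2) + B ^ 4 * (16 * pi / 3 / 1\<^sup>2) \<le> 1 + B ^ 4 * 7 * pi"
      using B0 by (simp add: field_simps)
    also have "\<dots> \<le> (1 + B ^ 4 * 7 * pi) ^ 4" using B0 by (intro self_le_power) auto
    finally show ?thesis using B0 by (simp add: add_nonneg_nonneg)
  qed
  ultimately have "Lp_le lborel 4 \<phi> (1 + B ^ 4 * 7 * pi)"
    using schwartz_measurable[OF assms] by (auto simp: Lp_le_def intro: order_trans ennreal_leI)
  moreover have "0 < 1 + B ^ 4 * 7 * pi" using B0 by (simp add: add_pos_nonneg)
  ultimately show thesis using that by blast
qed

section \<open>Density and duality\<close>

text \<open>Approximability is treated as a property of single functions. Stability under linear
  combinations and dominated limits then carries it from boxes to Borel subsets of boxes, to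
  truncated simple functions, and finally to all of L^4.\<close>

definition L4_closure :: "(plane \<Rightarrow> real) set" where
  "L4_closure = {\<psi>. \<psi> \<in> borel_measurable borel \<and>
     (\<forall>e>0. \<exists>\<phi>\<in>schwartz. Lp_le lborel 4 (\<lambda>x. \<psi> x - \<phi> x) e)}"

lemma L4_closure_measurable: "\<psi> \<in> L4_closure \<Longrightarrow> \<psi> \<in> borel_measurable borel"
  by (simp add: L4_closure_def)

lemma schwartz_in_L4_closure: "\<phi> \<in> schwartz \<Longrightarrow> \<phi> \<in> L4_closure"
  by (auto simp: L4_closure_def schwartz_measurable intro!: bexI[of _ \<phi>] Lp_le_zero)

lemma L4_closure_add:
  assumes "\<psi>1 \<in> L4_closure" "\<psi>2 \<in> L4_closure"
  shows "(\<lambda>x. \<psi>1 x + \<psi>2 x) \<in> L4_closure"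
  unfolding L4_closure_def mem_Collect_eq
proof (intro conjI allI impI)
  show "(\<lambda>x. \<psi>1 x + \<psi>2 x) \<in> borel_measurable borel"
    by (intro borel_measurable_add L4_closure_measurable assms)
  fix e :: real assume e: "0 < e"
  then have e2: "0 < e / 2" by simp
  obtain \<phi>1 where \<phi>1: "\<phi>1 \<in> schwartz" "Lp_le lborel 4 (\<lambda>x. \<psi>1 x - \<phi>1 x) (e / 2)"
    using assms(1) e2 unfolding L4_closure_def by blast
  obtain \<phi>2 where \<phi>2: "\<phi>2 \<in> schwartz" "Lp_le lborel 4 (\<lambda>x. \<psi>2 x - \<phi>2 x) (e / 2)"
    using assms(2) e2 unfolding L4_closure_def by blast
  have "Lp_le lborel 4 (\<lambda>x. (\<psi>1 x - \<phi>1 x) + (\<psi>2 x - \<phi>2 x)) (e / 2 + e / 2)"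
    by (intro Lp_le_add \<phi>1 \<phi>2 e2) auto
  moreover have "(\<lambda>x. \<phi>1 x + \<phi>2 x) \<in> schwartz"
    using schwartz_linear[OF \<phi>1(1) \<phi>2(1), of 1 1] by simp
  ultimately show "\<exists>\<phi>\<in>schwartz. Lp_le lborel 4 (\<lambda>x. \<psi>1 x + \<psi>2 x - \<phi> x) e"
    by (intro bexI[of _ "\<lambda>x. \<phi>1 x + \<phi>2 x"]) (auto simp: algebra_simps)
qed

lemma L4_closure_scale:
  assumes "\<psi> \<in> L4_closure"
  shows "(\<lambda>x. c * \<psi> x) \<in> L4_closure"
proof (cases "c = 0")
  case True
  then show ?thesis using schwartz_in_L4_closure[OF schwartz_zero] by simp
next
  case False
  show ?thesis
    unfolding L4_closure_def mem_Collect_eq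
  proof (intro conjI allI impI)
    show "(\<lambda>x. c * \<psi> x) \<in> borel_measurable borel"
      by (intro borel_measurable_times borel_measurable_const L4_closure_measurable assms)
    fix e :: real assume e: "0 < e"
    then have "0 < e / \<bar>c\<bar>" using False by simp
    then obtain \<phi> where \<phi>: "\<phi> \<in> schwartz" "Lp_le lborel 4 (\<lambda>x. \<psi> x - \<phi> x) (e / \<bar>c\<bar>)"
      using assms unfolding L4_closure_def by blast
    have "Lp_le lborel 4 (\<lambda>x. c * (\<psi> x - \<phi> x)) (\<bar>c\<bar> * (e / \<bar>c\<bar>))"
      by (intro Lp_le_scale \<phi>) (use e in auto)
    moreover have "(\<lambda>x. c * \<phi> x) \<in> schwartz"
      using schwartz_linear[OF \<phi>(1) \<phi>(1), of c 0] by simp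
    ultimately show "\<exists>\<phi>\<in>schwartz. Lp_le lborel 4 (\<lambda>x. c * \<psi> x - \<phi> x) e"
      using False by (intro bexI[of _ "\<lambda>x. c * \<phi> x"]) (auto simp: algebra_simps)
  qed
qed

lemma L4_closure_sum:
  assumes "finite I" "\<And>i. i \<in> I \<Longrightarrow> \<psi> i \<in> L4_closure"
  shows "(\<lambda>x. \<Sum>i\<in>I. \<psi> i x) \<in> L4_closure"
  using assms
proof (induction I)
  case empty
  then show ?case using schwartz_in_L4_closure[OF schwartz_zero] by simp
next
  case (insert i I)
  then show ?case by (auto intro!: L4_closure_add)
qed

text \<open>Dominated convergence gives convergence in L^4, after which a diagonal choice works:
  half of the error for the distance to some \<open>f n\<close>, half for the distance from
  \<open>f n\<close> to a Schwartz function.\<close>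

lemma L4_closure_dominated:
  fixes f :: "nat \<Rightarrow> plane \<Rightarrow> real"
  assumes f: "\<And>n. f n \<in> L4_closure" and g: "g \<in> borel_measurable borel"
    and w: "Lp_le lborel 4 w a"
    and bound: "\<And>n x. \<bar>f n x\<bar> \<le> w x"
    and lim: "AE x in lborel. (\<lambda>n. f n x) \<longlonglongrightarrow> g x"
  shows "g \<in> L4_closure"
  unfolding L4_closure_def mem_Collect_eq
proof (intro conjI allI impI g)
  fix e :: real assume e: "0 < e"
  note [measurable] = L4_closure_measurable[OF f] g
  have [measurable]: "w \<in> borel_measurable borel" using w by (simp add: Lp_le_def)
  have "(\<lambda>n. \<integral>\<^sup>+x. ennreal (\<bar>g x - f n x\<bar> powr 4) \<partial>lborel) \<longlonglongrightarrow> (\<integral>\<^sup>+(x::plane). 0 \<partial>lborel)"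
  \<comment> \<open>The limit inherits the bound \<open>w\<close> almost everywhere, so |g - f n| <=
    2w, and 16 is the fourth power of 2.\<close>
  proof (rule nn_integral_dominated_convergence[where w = "\<lambda>x. ennreal (16 * \<bar>w x\<bar> powr 4)"])
    show "(\<integral>\<^sup>+x. ennreal (16 * \<bar>w x\<bar> powr 4) \<partial>lborel) < \<infinity>"
    proof -
      have "(\<integral>\<^sup>+x. ennreal (16 * \<bar>w x\<bar> powr 4) \<partial>lborel) = ennreal 16 * (\<integral>\<^sup>+x. ennreal (\<bar>w x\<bar> powr 4) \<partial>lborel)"
        by (simp add: ennreal_mult' nn_integral_cmult)
      also have "\<dots> \<le> ennreal 16 * ennreal (a powr 4)"
        using w by (intro mult_left_mono) (auto simp: Lp_le_def)
      also have "\<dots> < \<infinity>" by (simp add: ennreal_mult_less_top)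
      finally show ?thesis .
    qed
    show "AE x in lborel. ennreal (\<bar>g x - f n x\<bar> powr 4) \<le> ennreal (16 * \<bar>w x\<bar> powr 4)" for n
      using lim
    proof eventually_elim
      case (elim x)
      have "\<bar>g x\<bar> \<le> w x"
        by (rule LIMSEQ_le_const2[OF tendsto_rabs[OF elim]]) (use bound in auto)
      then have "\<bar>g x - f n x\<bar> powr 4 \<le> (2 * \<bar>w x\<bar>) powr 4"
        using bound[of n x] by (intro powr_mono2) auto
      also have "\<dots> = 16 * \<bar>w x\<bar> powr 4" by (simp add: power_mult_distrib)
      finally show ?case by (rule ennreal_leI)
    qed
    show "AE x in lborel. (\<lambda>n. ennreal (\<bar>g x - f n x\<bar> powr 4)) \<longlonglongrightarrow> 0"
      using lim
    proof eventually_elim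
      case (elim x)
      have "(\<lambda>n. \<bar>g x - f n x\<bar> ^ 4) \<longlonglongrightarrow> \<bar>g x - g x\<bar> ^ 4"
        by (intro tendsto_intros elim)
      then have "(\<lambda>n. ennreal (\<bar>g x - f n x\<bar> ^ 4)) \<longlonglongrightarrow> ennreal (\<bar>g x - g x\<bar> ^ 4)"
        by (rule tendsto_ennrealI)
      then show ?case by simp
    qed
  qed measurable
  then have "(\<lambda>n. \<integral>\<^sup>+x. ennreal (\<bar>g x - f n x\<bar> powr 4) \<partial>lborel) \<longlonglongrightarrow> 0" by simp
  moreover have "0 < ennreal ((e / 2) powr 4)" using e by simp
  ultimately have "eventually (\<lambda>n. (\<integral>\<^sup>+x. ennreal (\<bar>g x - f n x\<bar> powr 4) \<partial>lborel) < ennreal ((e / 2) powr 4)) sequentially"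
    by (rule order_tendstoD)
  then obtain n where "(\<integral>\<^sup>+x. ennreal (\<bar>g x - f n x\<bar> powr 4) \<partial>lborel) < ennreal ((e / 2) powr 4)"
    by (auto simp: eventually_sequentially)
  then have n: "Lp_le lborel 4 (\<lambda>x. g x - f n x) (e / 2)"
    by (auto simp: Lp_le_def)
  have e2: "0 < e / 2" using e by simp
  obtain \<phi> where \<phi>: "\<phi> \<in> schwartz" "Lp_le lborel 4 (\<lambda>x. f n x - \<phi> x) (e / 2)"
    using f[of n] e2 unfolding L4_closure_def by blast
  have "Lp_le lborel 4 (\<lambda>x. (g x - f n x) + (f n x - \<phi> x)) (e / 2 + e / 2)"
    by (intro Lp_le_add n \<phi> e2) auto
  then show "\<exists>\<phi>\<in>schwartz. Lp_le lborel 4 (\<lambda>x. g x - \<phi> x) e"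
    using \<phi> by (intro bexI[of _ \<phi>]) auto
qed

section \<open>Approximating indicators of boxes, of Borel sets, and general L^4 functions\<close>

lemma box_minus_null:
  fixes a b :: plane
  shows "AE x in lborel. x \<notin> cbox a b - box a b"
proof -
  have "negligible (cbox a b - box a b)" by (rule negligible_frontier_interval)
  then have "cbox a b - box a b \<in> null_sets lebesgue" by (simp add: negligible_iff_null_sets)
  then have "cbox a b - box a b \<in> null_sets lborel"
    by (auto simp: null_sets_def)
  then show ?thesis by (rule AE_not_in)
qed

text \<open>The indicator of a box is the limit of \<open>exp (- z\<^sub>1 ^ (2 * n) - z\<^sub>2 ^ (2 * n))\<close>, where
  \<open>z\<^sub>1\<close>, \<open>z\<^sub>2\<close> are the coordinates normalised so that the box becomes \<open>]-1, 1[\<^sup>2\<close>.\<close>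

lemma box_in_L4_closure:
  fixes a b :: plane
  shows "indicator (box a b) \<in> L4_closure"
proof (cases "box a b = {}")
  case True
  have "indicator (box a b) = (\<lambda>x::plane. 0::real)" unfolding True by auto
  then show ?thesis using schwartz_in_L4_closure[OF schwartz_zero] by simp
next
  case False
  then have ab: "a $ i < b $ i" for i
    using interval_eq_empty_cart(1)[of a b] by (auto simp: not_le)
  define z where "z i x = (2 * x $ i - a $ i - b $ i) / (b $ i - a $ i)" for i and x :: plane
  \<comment> \<open>The exponent starts at 2 because of \<open>Suc n\<close>. With exponent 0 the
    first function would be a nonzero constant, and it could not serve as the integrable majorant of
    the sequence.\<close>
  define q where "q n x = (\<Sum>i\<in>UNIV. (z i x ^ 2) ^ Suc n)" for n and x :: plane
  define f where "f n x = exp (- q n x)" for n and x :: plane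
  define D where "D = (\<Sum>i\<in>UNIV. b $ i - a $ i)"
  define A where "A = (\<Sum>i\<in>UNIV. \<bar>a $ i + b $ i\<bar>)"
  have D: "b $ i - a $ i \<le> D" for i
    unfolding D_def using ab by (intro member_le_sum) (auto simp: less_imp_le)
  have D0: "0 < D" using ab[of 1] D[of 1] by linarith
  have A: "\<bar>a $ i + b $ i\<bar> \<le> A" for i
    unfolding A_def by (intro member_le_sum) auto
  \<comment> \<open>For s >= 0 one has s - 1 <= s^(n+1): by monotonicity of powers if s >= 1, and by
    sign otherwise. This elementary bound, uniform in \<open>n\<close>, yields both the coercivity
    of \<open>q n\<close> and the domination of the whole sequence by its first member.\<close>
  have zpow: "z i x ^ 2 - 1 \<le> (z i x ^ 2) ^ Suc n" for i x n
  proof (cases "1 \<le> z i x ^ 2")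
    case True
    from self_le_power[OF this, of "Suc n"] show ?thesis by simp
  next
    case False
    have "0 \<le> (z i x ^ 2) ^ Suc n" by (rule zero_le_power) simp
    with False show ?thesis by linarith
  qed
  have poly: "real_polynomial_function (q n)" for n
    unfolding q_def z_def
    by (intro real_polynomial_function_sum real_polynomial_function_power real_polynomial_function_divide
        real_polynomial_function_diff real_polynomial_function.intros bounded_linear_vec_nth) auto
  \<comment> \<open>Per coordinate, 2|x_i| <= |z_i| D + A, combined with 2|z_i| - 1 <= z_i^2 and
    \<open>zpow\<close>, gives a linear lower bound. Summing over the two coordinates and comparing
    with the l^1 norm yields the constants.\<close>
  have coercive: "(4 / D) * norm x - 2 * (2 * A / D + 2) \<le> q n x" for n x
  proof -
    have "4 / D * \<bar>x $ i\<bar> - (2 * A / D + 2) \<le> (z i x ^ 2) ^ Suc n" for i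
    proof -
      have "2 * x $ i = z i x * (b $ i - a $ i) + (a $ i + b $ i)"
        using ab[of i] by (simp add: z_def)
      then have "\<bar>2 * x $ i\<bar> \<le> \<bar>z i x * (b $ i - a $ i)\<bar> + \<bar>a $ i + b $ i\<bar>"
        by (simp only: abs_triangle_ineq)
      also have "\<dots> \<le> \<bar>z i x\<bar> * D + A"
        unfolding abs_mult using D[of i] A[of i] ab[of i] by (intro add_mono mult_left_mono) auto
      finally have "2 * \<bar>x $ i\<bar> - A \<le> \<bar>z i x\<bar> * D" by simp
      then have "(2 * \<bar>x $ i\<bar> - A) / D \<le> \<bar>z i x\<bar>" using D0 by (simp add: pos_divide_le_eq)
      then have "4 / D * \<bar>x $ i\<bar> - 2 * A / D \<le> 2 * \<bar>z i x\<bar>" by (simp add: diff_divide_distrib)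
      moreover have "2 * \<bar>z i x\<bar> - 1 \<le> z i x ^ 2"
      proof -
        have "0 \<le> (\<bar>z i x\<bar> - 1) ^ 2" by simp
        then have "0 \<le> z i x ^ 2 + 1 - 2 * \<bar>z i x\<bar>"
          by (simp only: power2_diff power2_abs one_power2 mult_1_right)
        then show ?thesis by linarith
      qed
      ultimately show ?thesis using zpow[of i x n] by linarith
    qed
    then have "(\<Sum>i\<in>UNIV. 4 / D * \<bar>x $ i\<bar> - (2 * A / D + 2)) \<le> q n x"
      unfolding q_def by (intro sum_mono)
    moreover have "(\<Sum>i\<in>UNIV. 4 / D * \<bar>x $ i\<bar> - (2 * A / D + 2))
        = 4 / D * (\<Sum>i\<in>UNIV. \<bar>x $ i\<bar>) - 2 * (2 * A / D + 2)"
      by (simp add: sum_subtractf sum_distrib_left)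
    moreover have "4 / D * norm x \<le> 4 / D * (\<Sum>i\<in>UNIV. \<bar>x $ i\<bar>)"
      using D0 norm_le_l1_cart[of x] by (intro mult_left_mono) auto
    ultimately show ?thesis by linarith
  qed
  have schw: "f n \<in> schwartz" for n
  proof -
    have "(\<lambda>x. 1 * exp (- q n x)) \<in> schwartz"
      by (rule schwartz_poly_exp[OF real_polynomial_function.intros(2) poly _ coercive]) (use D0 in auto)
    then show ?thesis by (simp add: f_def[abs_def])
  qed
  obtain B where B: "0 < B" "Lp_le lborel 4 (f 0) B"
    using schwartz_Lp_le_4[OF schw[of 0]] .
  \<comment> \<open>Summing \<open>zpow\<close> over two coordinates loses 2 in the exponent, hence
    the factor exp 2.\<close>
  have dom: "\<bar>f n x\<bar> \<le> exp 2 * f 0 x" for n x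
  proof -
    have "(\<Sum>i\<in>UNIV. z i x ^ 2 - 1) \<le> q n x"
      unfolding q_def by (intro sum_mono zpow)
    then have "q 0 x - 2 \<le> q n x" by (simp add: q_def sum_subtractf)
    then show ?thesis by (simp add: f_def flip: exp_add)
  qed
  have "AE x in lborel. (\<lambda>n. f n x) \<longlonglongrightarrow> indicator (box a b) x"
    using box_minus_null[of a b]
  proof eventually_elim
    case (elim x)
    consider "x \<in> box a b" | "x \<notin> cbox a b" using elim by blast
    then show ?case
    proof cases
      case 1
      have "z i x ^ 2 < 1" for i
      proof -
        have "a $ i < x $ i" "x $ i < b $ i" using 1 by (auto simp: mem_box_cart)
        then have "\<bar>z i x\<bar> < 1" using ab[of i] by (auto simp: z_def abs_less_iff field_simps)
        then show ?thesis by (simp add: abs_square_less_1)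
      qed
      then have "(\<lambda>n. (z i x ^ 2) ^ Suc n) \<longlonglongrightarrow> 0" for i
        by (intro LIMSEQ_Suc LIMSEQ_realpow_zero) auto
      then have "(\<lambda>n. exp (- q n x)) \<longlonglongrightarrow> exp (- (\<Sum>i\<in>(UNIV::2 set). 0))"
        unfolding q_def by (intro tendsto_intros)
      then show ?thesis using 1 by (simp add: f_def)
    next
      case 2
      then obtain i where "\<not> (a $ i \<le> x $ i \<and> x $ i \<le> b $ i)" by (auto simp: mem_box_cart)
      then have "z i x < - 1 \<or> 1 < z i x" using ab[of i] by (auto simp: z_def field_simps)
      then have "1 < \<bar>z i x\<bar>" by linarith
      then have z1: "1 < z i x ^ 2" by (metis abs_square_le_1 not_le)
      have "(\<lambda>n. inverse ((z i x ^ 2) ^ Suc n)) \<longlonglongrightarrow> 0"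
        by (intro LIMSEQ_Suc LIMSEQ_inverse_realpow_zero z1)
      \<comment> \<open>Outside the closed box one coordinate has |z_i| > 1, and exp(-q) <= 1/q is
        at most the reciprocal of that coordinate's summand, which tends to 0. Only the boundary of
        the box, a null set, escapes both cases.\<close>
      moreover have "norm (f n x) \<le> norm (inverse ((z i x ^ 2) ^ Suc n))" for n
      proof -
        have p: "0 < (z i x ^ 2) ^ Suc n" using z1 by (rule zero_less_power[OF less_trans[OF zero_less_one]])
        have "(z i x ^ 2) ^ Suc n \<le> q n x"
          unfolding q_def by (rule member_le_sum) auto
        also have "\<dots> \<le> exp (q n x)" using exp_ge_add_one_self[of "q n x"] by linarith
        finally show ?thesis using p by (simp add: f_def exp_minus le_imp_inverse_le del: power_Suc)
      qed
      ultimately have "(\<lambda>n. f n x) \<longlonglongrightarrow> 0"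
        by (intro Lim_null_comparison[of "\<lambda>n. f n x" "\<lambda>n. norm (inverse ((z i x ^ 2) ^ Suc n))"])
          (auto simp del: power_Suc intro: tendsto_norm_zero)
      moreover have "x \<notin> box a b" using 2 box_subset_cbox by blast
      ultimately show ?thesis by simp
    qed
  qed
  moreover have "Lp_le lborel 4 (\<lambda>x. exp 2 * f 0 x) (\<bar>exp 2\<bar> * B)"
    by (rule Lp_le_scale) (use B in auto)
  ultimately show ?thesis
    by (intro L4_closure_dominated[OF schwartz_in_L4_closure[OF schw] _ _ dom]) auto
qed

lemma Lp_le_indicator_box:
  fixes c d :: plane
  assumes p: "0 < p"
  obtains B where "0 < B" "Lp_le lborel p (indicator (box c d)) B"
proof -
  define m where "m = measure lborel (box c d)"
  have [measurable]: "box c d \<in> sets borel" by simp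
  have "(\<integral>\<^sup>+x. ennreal (\<bar>indicator (box c d) x\<bar> powr p) \<partial>lborel) = (\<integral>\<^sup>+x. indicator (box c d) x \<partial>lborel)"
    by (intro nn_integral_cong) (auto simp: indicator_def)
  also have "\<dots> = emeasure lborel (box c d)" by simp
  also have "\<dots> = ennreal m"
    unfolding m_def by (rule emeasure_eq_ennreal_measure) (use emeasure_lborel_box_finite[of c d] in auto)
  also have "\<dots> \<le> ennreal (((1 + m) powr (1 / p)) powr p)"
    using p by (auto simp: powr_powr m_def intro!: ennreal_leI)
  finally have "Lp_le lborel p (indicator (box c d)) ((1 + m) powr (1 / p))"
    by (simp add: Lp_le_def)
  moreover have "0 < (1 + m) powr (1 / p)"
  proof -
    have "0 \<le> m" by (simp add: m_def)
    then show ?thesis by simp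
  qed
  ultimately show thesis using that by blast
qed

text \<open>Induction over the sigma-algebra generated by the boxes, which are stable under
  intersection. Cutting with a fixed box keeps everything in L^4: complements become differences
  from that box, and partial unions of disjoint sets are dominated by its indicator.\<close>

lemma Int_box_in_L4_closure:
  fixes c d :: plane
  assumes "A \<in> sets borel"
  shows "indicator (A \<inter> box c d) \<in> L4_closure"
proof -
  have "Int_stable (range (\<lambda>(a, b). box a b :: plane set))"
    by (auto simp: Int_stable_def box_Int_box)
  moreover have "(range (\<lambda>(a, b). box a b :: plane set)) \<subseteq> Pow UNIV"
    by auto
  moreover have "A \<in> sigma_sets UNIV (range (\<lambda>(a, b). box a b))"
    using assms unfolding borel_eq_box by simp
  ultimately show ?thesis
  proof (induction rule: sigma_sets_induct_disjoint)
    case (basic A)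
    then show ?case by (auto simp: box_Int_box intro!: box_in_L4_closure)
  next
    case empty
    have "indicator ({} \<inter> box c d) = (\<lambda>x::plane. 0::real)" by auto
    then show ?case using schwartz_in_L4_closure[OF schwartz_zero] by simp
  next
    case (compl A)
    have "(\<lambda>x. indicator (box c d) x + (- 1) * indicator (A \<inter> box c d) x) \<in> L4_closure"
      by (intro L4_closure_add box_in_L4_closure L4_closure_scale compl)
    moreover have "(\<lambda>x. indicator (box c d) x + (- 1) * indicator (A \<inter> box c d) x)
        = (indicator ((UNIV - A) \<inter> box c d) :: plane \<Rightarrow> real)"
      by (auto simp: indicator_def)
    ultimately show ?case by simp
  next
    case (union A)
    have [measurable]: "A i \<in> sets borel" for i
      using union(2) by (auto simp: borel_eq_box)
    obtain B where B: "Lp_le lborel 4 (indicator (box c d) :: plane \<Rightarrow> real) B"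
      using Lp_le_indicator_box[of 4 c d] by auto
    show ?case
    proof (rule L4_closure_dominated[OF _ _ B])
      fix n :: nat
      show "(\<lambda>x. \<Sum>i<n. indicator (A i \<inter> box c d) x) \<in> L4_closure"
        by (intro L4_closure_sum union) auto
      have eq: "(\<Sum>i<n. indicator (A i \<inter> box c d) x) = (indicator (\<Union>i<n. A i \<inter> box c d) x :: real)" for x
        by (rule indicator_UN_disjoint[symmetric]) (use union(1) in \<open>auto simp: disjoint_family_on_def\<close>)
      show "\<bar>\<Sum>i<n. indicator (A i \<inter> box c d) x\<bar> \<le> (indicator (box c d) x :: real)" for x
        unfolding eq by (auto simp: indicator_def)
    next
      have "(\<lambda>n. \<Sum>i<n. indicator (A i \<inter> box c d) x) \<longlonglongrightarrow> (indicator (\<Union> (range A) \<inter> box c d) x :: real)" for x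
      proof -
        have eq: "(\<Sum>i<n. indicator (A i \<inter> box c d) x) = (indicator (\<Union>i<n. A i \<inter> box c d) x :: real)" for n
          by (rule indicator_UN_disjoint[symmetric]) (use union(1) in \<open>auto simp: disjoint_family_on_def\<close>)
        show ?thesis
          unfolding eq using LIMSEQ_indicator_UN[of "\<lambda>i. A i \<inter> box c d" x] by simp
      qed
      then show "AE x in lborel. (\<lambda>n. \<Sum>i<n. indicator (A i \<inter> box c d) x) \<longlonglongrightarrow> (indicator (\<Union> (range A) \<inter> box c d) x :: real)"
        by simp
    qed measurable
  qed
qed

text \<open>Simple functions converging to \<open>\<psi>\<close> are cut off to the growing squares
  \<open>Q n\<close>. Each is a finite combination of indicators of Borel subsets of a box, and all
  are dominated by 2|psi|.\<close>

lemma L4_subset_L4_closure: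
  fixes \<psi> :: "plane \<Rightarrow> real"
  assumes \<psi>: "Lp_le lborel 4 \<psi> c" and c: "0 \<le> c"
  shows "\<psi> \<in> L4_closure"
proof -
  have \<psi>m [measurable]: "\<psi> \<in> borel_measurable borel" using \<psi> by (simp add: Lp_le_def)
  define Q :: "nat \<Rightarrow> plane set" where "Q n = box (\<chi> i. - real n) (\<chi> i. real n)" for n
  obtain s where s: "\<And>i. simple_function borel (s i)" "\<And>x. (\<lambda>i. s i x) \<longlonglongrightarrow> \<psi> x"
    "\<And>i x. \<bar>s i x\<bar> \<le> 2 * \<bar>\<psi> x\<bar>"
    using borel_measurable_implies_sequence_metric[OF \<psi>m, of 0] by auto
  have "(\<lambda>x. s n x * indicator (Q n) x) \<in> L4_closure" for n
  proof -
    have "s n x * indicator (Q n) x = (\<Sum>y\<in>range (s n). y * indicator (s n -` {y} \<inter> Q n) x)" for x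
    proof -
      have fin: "finite (range (s n))" using simple_functionD(1)[OF s(1)[of n]] by simp
      have "(\<Sum>y\<in>range (s n). y * indicator (s n -` {y} \<inter> Q n) x)
         = (\<Sum>y\<in>range (s n). if y = s n x then y * indicator (Q n) x else 0)"
        by (intro sum.cong) (auto simp: indicator_def)
      also have "\<dots> = s n x * indicator (Q n) x" using fin by (simp add: sum.delta)
      finally show ?thesis by simp
    qed
    moreover have "(\<lambda>x. \<Sum>y\<in>range (s n). y * indicator (s n -` {y} \<inter> Q n) x) \<in> L4_closure"
      unfolding Q_def using s(1)[of n]
      by (intro L4_closure_sum L4_closure_scale Int_box_in_L4_closure) (auto dest: simple_functionD)
    ultimately show ?thesis by simp
  qed
  moreover have "Lp_le lborel 4 (\<lambda>x. 2 * \<bar>\<psi> x\<bar>) (\<bar>2\<bar> * c)"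
    by (rule Lp_le_scale) (use \<psi> c in \<open>auto simp: Lp_le_def\<close>)
  moreover have "\<bar>s n x * indicator (Q n) x\<bar> \<le> 2 * \<bar>\<psi> x\<bar>" for n x
    using s(3)[of n x] by (auto simp: indicator_def)
  moreover have "(\<lambda>n. s n x * indicator (Q n) x) \<longlonglongrightarrow> \<psi> x" for x
  proof (rule Lim_transform_eventually[OF s(2)])
    obtain m :: nat where m: "norm x < real m" using reals_Archimedean2 by blast
    have "x \<in> Q n" if "m \<le> n" for n
    proof -
      have "\<bar>x $ i\<bar> < real n" for i
        using component_le_norm_cart[of x i] m that by linarith
      then show ?thesis by (auto simp: Q_def mem_box_cart abs_less_iff minus_less_iff)
    qed
    then show "\<forall>\<^sub>F n in sequentially. s n x = s n x * indicator (Q n) x"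
      by (auto simp: eventually_sequentially intro!: exI[of _ m])
  qed
  ultimately show ?thesis
    by (intro L4_closure_dominated[of "\<lambda>n x. s n x * indicator (Q n) x" \<psi> "\<lambda>x. 2 * \<bar>\<psi> x\<bar>"]) auto
qed

text \<open>Testing against Schwartz functions close to the extremal function
  \<open>sgn g * \<bar>g\<bar> powr (1/3)\<close>.\<close>

lemma Lp_le_by_duality:
  fixes g :: "plane \<Rightarrow> real"
  assumes g: "g \<in> Lp (4/3)" and A: "0 \<le> A"
    and dual: "\<And>\<phi> b. \<phi> \<in> schwartz \<Longrightarrow> 0 < b \<Longrightarrow> Lp_le lborel 4 \<phi> b \<Longrightarrow> \<bar>LINT x|lborel. g x * \<phi> x\<bar> \<le> A * b"
  shows "Lp_norm (4/3) g \<le> A"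
proof -
  define N where "N = Lp_norm (4/3) g"
  have N0: "0 \<le> N" by (simp add: N_def Lp_norm_nonneg)
  show ?thesis
  proof (cases "N = 0")
    case True
    then show ?thesis using A by (simp add: N_def)
  next
    case False
    with N0 have N: "0 < N" by simp
    have gm [measurable]: "g \<in> borel_measurable borel" using g by (simp add: Lp_def)
    have gN: "Lp_le lborel (4/3) g N" using g by (intro Lp_le_of_Lp) (auto simp: N_def)
    have int: "integrable lborel (\<lambda>x. \<bar>g x\<bar> powr (4/3))" using g by (simp add: Lp_def)
    have NI: "(LINT x|lborel. \<bar>g x\<bar> powr (4/3)) = N powr (4/3)"
      by (simp add: N_def Lp_norm_def powr_powr)
    define \<psi> where "\<psi> x = sgn (g x) * \<bar>g x\<bar> powr (1/3)" for x
    have [measurable]: "\<psi> \<in> borel_measurable borel" unfolding \<psi>_def by measurable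
    have \<psi>4: "\<bar>\<psi> x\<bar> powr 4 = \<bar>g x\<bar> powr (4/3)" for x
    proof (cases "g x = 0")
      case False
      have "\<bar>\<psi> x\<bar> powr 4 = (\<bar>g x\<bar> powr (1/3)) powr 4" using False by (simp add: \<psi>_def abs_mult)
      also have "\<dots> = \<bar>g x\<bar> powr (4/3)" by (simp only: powr_powr) simp
      finally show ?thesis .
    qed (simp add: \<psi>_def)
    have g\<psi>: "g x * \<psi> x = \<bar>g x\<bar> powr (4/3)" for x
    proof (cases "g x = 0")
      case False
      have "g x * \<psi> x = \<bar>g x\<bar> powr 1 * \<bar>g x\<bar> powr (1/3)" using False by (auto simp: \<psi>_def sgn_if)
      also have "\<dots> = \<bar>g x\<bar> powr (4/3)" by (simp only: powr_add[symmetric]) simp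
      finally show ?thesis .
    qed (simp add: \<psi>_def)
    \<comment> \<open>\<open>M\<close> is the L^4 norm of the extremal function, and N M = N^(4/3)
      is the value of its pairing with \<open>g\<close>. Dividing by M > 0 at the end gives N <=
      A.\<close>
    define M where "M = N powr (1/3)"
    have M: "0 < M" using N by (simp add: M_def)
    have NM: "N powr (4/3) = N * M" using N by (simp add: M_def powr_mult_base)
    have \<psi>M: "Lp_le lborel 4 \<psi> M"
    proof -
      have "(\<integral>\<^sup>+x. ennreal (\<bar>\<psi> x\<bar> powr 4) \<partial>lborel) = ennreal (N powr (4/3))"
        unfolding \<psi>4 using int NI by (simp add: nn_integral_eq_integral)
      also have "N powr (4/3) = M powr 4" unfolding M_def powr_powr by simp
      finally show ?thesis by (simp add: Lp_le_def)
    qed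
    \<comment> \<open>The test function has norm at most M + e, which costs A e in the assumed
      bound; the remainder, of norm at most \<open>e\<close>, costs N e by Hoelder.\<close>
    have approx: "N * M \<le> A * M + e * (A + N)" if e: "0 < e" for e
    proof -
      have "\<psi> \<in> L4_closure" using \<psi>M M by (intro L4_subset_L4_closure) auto
      then obtain \<phi> where \<phi>: "\<phi> \<in> schwartz" "Lp_le lborel 4 (\<lambda>x. \<psi> x - \<phi> x) e"
        using e unfolding L4_closure_def by blast
      have "Lp_le lborel 4 (\<lambda>x. \<psi> x - (\<psi> x - \<phi> x)) (M + e)"
        by (rule Lp_le_diff[OF \<psi>M \<phi>(2) M e]) simp
      then have \<phi>M: "Lp_le lborel 4 \<phi> (M + e)" by simp
      have i1: "integrable lborel (\<lambda>x. g x * \<phi> x)"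
        by (rule Holder_integrable[OF gN \<phi>M]) (use N M e in auto)
      have i2: "integrable lborel (\<lambda>x. g x * (\<psi> x - \<phi> x))" "\<bar>LINT x|lborel. g x * (\<psi> x - \<phi> x)\<bar> \<le> N * e"
        by (rule Holder_integrable[OF gN \<phi>(2)]; use N M e in simp)+
      have "N * M = (LINT x|lborel. g x * \<psi> x)" by (simp add: g\<psi> NI NM)
      also have "\<dots> = (LINT x|lborel. g x * \<phi> x + g x * (\<psi> x - \<phi> x))"
        by (intro Bochner_Integration.integral_cong) (auto simp: algebra_simps)
      also have "\<dots> = (LINT x|lborel. g x * \<phi> x) + (LINT x|lborel. g x * (\<psi> x - \<phi> x))"
        by (rule Bochner_Integration.integral_add[OF i1 i2(1)])
      also have "\<dots> \<le> A * (M + e) + N * e"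
        using dual[OF \<phi>(1) _ \<phi>M] i2(2) M e by (intro add_mono) auto
      finally show ?thesis by (simp add: algebra_simps)
    qed
    have "N * M \<le> A * M"
    proof (rule field_le_epsilon)
      fix \<delta> :: real assume "0 < \<delta>"
      moreover have "0 < A + N" using A N by simp
      ultimately show "N * M \<le> A * M + \<delta>" using approx[of "\<delta> / (A + N)"] by simp
    qed
    then show ?thesis using M by (simp add: N_def)
  qed
qed

section \<open>The Gaussian kernel\<close>

text \<open>The gradient with respect to \<open>y\<close> of the kernel at z = x - y, hence the
  negative of its gradient in \<open>z\<close>. This is the form that arises when a divergence is
  tested against the kernel.\<close>

definition heat_kernel_grad :: "real \<Rightarrow> plane \<Rightarrow> plane" where
  "heat_kernel_grad s z = (heat_kernel z s / (2 * s)) *\<^sub>R z"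

lemma borel_measurable_heat_kernel_grad [measurable]: "heat_kernel_grad s \<in> borel_measurable borel"
  unfolding heat_kernel_grad_def heat_kernel_def by measurable

lemma gradient_heat_kernel:
  assumes s: "0 < s"
  shows "gradient (\<lambda>y. heat_kernel (x - y) s) y = heat_kernel_grad s (x - y)"
proof -
  have d: "((\<lambda>y. heat_kernel (x - y) s) has_derivative (\<lambda>v. heat_kernel_grad s (x - y) \<bullet> v)) (at y)"
  proof -
    have "((\<lambda>y. (x - y) \<bullet> (x - y)) has_derivative (\<lambda>v. (x - y) \<bullet> (- v) + (- v) \<bullet> (x - y))) (at y)"
      by (intro has_derivative_inner) (auto intro!: derivative_eq_intros)
    then have "((\<lambda>y. - 1 / (4 * s) * ((x - y) \<bullet> (x - y))) has_derivative
        (\<lambda>v. - 1 / (4 * s) * ((x - y) \<bullet> (- v) + (- v) \<bullet> (x - y)))) (at y)"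
      by (rule has_derivative_mult_right)
    then have "((\<lambda>y. exp (- 1 / (4 * s) * ((x - y) \<bullet> (x - y)))) has_derivative
        (\<lambda>v. (- 1 / (4 * s) * ((x - y) \<bullet> (- v) + (- v) \<bullet> (x - y))) * exp (- 1 / (4 * s) * ((x - y) \<bullet> (x - y))))) (at y)"
      by (rule has_derivative_exp)
    then have "((\<lambda>y. 1 / (4 * pi * s) * exp (- 1 / (4 * s) * ((x - y) \<bullet> (x - y)))) has_derivative
        (\<lambda>v. 1 / (4 * pi * s) * ((- 1 / (4 * s) * ((x - y) \<bullet> (- v) + (- v) \<bullet> (x - y))) *
          exp (- 1 / (4 * s) * ((x - y) \<bullet> (x - y)))))) (at y)"
      by (rule has_derivative_mult_right)
    moreover have "1 / (4 * pi * s) * exp (- 1 / (4 * s) * ((x - y) \<bullet> (x - y))) = heat_kernel (x - y) s" for y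
      by (simp add: heat_kernel_def power2_norm_eq_inner)
    moreover have "1 / (4 * pi * s) * ((- 1 / (4 * s) * ((x - y) \<bullet> (- v) + (- v) \<bullet> (x - y))) *
          exp (- 1 / (4 * s) * ((x - y) \<bullet> (x - y)))) = heat_kernel_grad s (x - y) \<bullet> v" for v
    proof -
      have "- 1 / (4 * s) * ((x - y) \<bullet> (- v) + (- v) \<bullet> (x - y)) = ((x - y) \<bullet> v) / (2 * s)"
        using s by (simp add: inner_commute[of v])
      then show ?thesis
        unfolding heat_kernel_grad_def heat_kernel_def power2_norm_eq_inner by simp
    qed
    ultimately show ?thesis by simp
  qed
  show ?thesis
    unfolding gradient_def partial_def frechet_derivative_at[OF d, symmetric]
    by (simp add: inner_axis vec_eq_iff)
qed

lemma norm_heat_kernel_grad: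
  assumes s: "0 < s"
  shows "norm (heat_kernel_grad s z) = norm z / (8 * pi * s\<^sup>2) * exp (- ((norm z)\<^sup>2 / (4 * s)))"
  using s by (simp add: heat_kernel_grad_def heat_kernel_def power2_eq_square ac_simps)

text \<open>With q the square root of s, the square of |z|/2 - q being nonnegative gives |z| <= q(1
  + |z|^2/(4s)), and 1 + w <= exp w absorbs the last factor into the Gaussian. Hence |z| times the
  Gaussian factor is at most \<open>q\<close>.\<close>

lemma norm_heat_kernel_grad_le:
  assumes s: "0 < s"
  shows "norm (heat_kernel_grad s z) \<le> s powr (-3/2)"
proof -
  define q where "q = s powr (1/2)"
  have q: "0 < q" "s = q\<^sup>2" "s powr (-3/2) = 1 / q ^ 3"
    using s by (auto simp: q_def powr_power powr_minus field_simps simp flip: powr_add)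
  define w where "w = (norm z)\<^sup>2 / (4 * s)"
  have "0 \<le> (norm z / 2 - q)\<^sup>2" by simp
  then have "norm z * q \<le> (norm z)\<^sup>2 / 4 + q\<^sup>2" by (simp add: power2_diff power_divide)
  then have "norm z \<le> ((norm z)\<^sup>2 / 4 + q\<^sup>2) / q" using q(1) by (simp add: pos_le_divide_eq)
  also have "\<dots> = q * (1 + w)" using q(1) by (simp add: w_def q(2) field_simps power2_eq_square)
  also have "\<dots> \<le> q * exp w" using q(1) by (intro mult_left_mono) auto
  finally have "norm z * exp (- w) \<le> q" by (simp add: exp_minus field_simps)
  then have "norm z * exp (- w) / (8 * pi * s\<^sup>2) \<le> q / (8 * pi * s\<^sup>2)"
    using s by (intro divide_right_mono) auto
  also have "\<dots> \<le> q / (1 * s\<^sup>2)"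
    using s q pi_gt3 by (intro divide_left_mono mult_right_mono) auto
  also have "\<dots> = 1 / q ^ 3"
    using q(1) unfolding q(2) by (simp add: field_simps power2_eq_square power3_eq_cube)
  finally show ?thesis using q(3) by (simp add: norm_heat_kernel_grad[OF s] w_def)
qed

text \<open>From w^2/2 <= exp w the Gaussian factor is at most 32 s^2/|z|^4. The powers of
  \<open>s\<close> cancel against the prefactor, so the decay is uniform in \<open>s\<close>; the
  resulting constant 4/pi is below 2.\<close>

lemma norm_heat_kernel_grad_decay:
  assumes s: "0 < s" and z: "z \<noteq> 0"
  shows "norm (heat_kernel_grad s z) \<le> 2 / norm z ^ 3"
proof -
  define w where "w = (norm z)\<^sup>2 / (4 * s)"
  have w: "0 < w" using s z by (simp add: w_def)
  have "w\<^sup>2 / 2 \<le> exp w" using exp_lower_Taylor_quadratic[of w] w by simp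
  then have "w\<^sup>2 * exp (- w) \<le> 2" by (simp add: exp_minus field_simps)
  then have "16 * s\<^sup>2 / norm z ^ 4 * (w\<^sup>2 * exp (- w)) \<le> 16 * s\<^sup>2 / norm z ^ 4 * 2"
    using z by (intro mult_left_mono) auto
  also have "16 * s\<^sup>2 / norm z ^ 4 * (w\<^sup>2 * exp (- w)) = exp (- w)"
    using z s by (simp add: w_def power_divide power_mult_distrib)
  finally have "norm z / (8 * pi * s\<^sup>2) * exp (- w) \<le> norm z / (8 * pi * s\<^sup>2) * (16 * s\<^sup>2 / norm z ^ 4 * 2)"
    by (intro mult_left_mono) auto
  also have "\<dots> = (4 / pi) / norm z ^ 3"
    using z s by (simp add: field_simps power4_eq_xxxx power3_eq_cube)
  also have "\<dots> \<le> 2 / norm z ^ 3"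
    using pi_gt3 by (intro divide_right_mono) (auto simp: field_simps)
  finally show ?thesis by (simp add: norm_heat_kernel_grad[OF s] w_def)
qed

text \<open>With the disc of radius sqrt s, the integral of the 4/3 power is at most pi/s inside and
  4 * 16 pi/(3 s) outside, in total 67 pi/(3 s). Here 4 bounds 2^(4/3). Taking the power 3/4 also
  produces the rate s^(-3/4).\<close>

definition heat_const :: real where
  "heat_const = (67 * pi / 3) powr (3/4)"

lemma heat_const_pos: "0 < heat_const"
  by (simp add: heat_const_def)

lemma heat_kernel_grad_Lp_le:
  assumes s: "0 < s"
  shows "Lp_le lborel (4/3) (\<lambda>x. norm (heat_kernel_grad s (x - y))) (heat_const * s powr (-3/4))"
proof -
  have "(\<integral>\<^sup>+x. ennreal (\<bar>norm (heat_kernel_grad s (x - y))\<bar> powr (4/3)) \<partial>lborel)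
    \<le> ennreal (1 / s\<^sup>2 * (pi * (sqrt s)\<^sup>2) + 4 * (16 * pi / 3 / (sqrt s)\<^sup>2))"
  proof (rule nn_integral_decay_bound)
    fix x
    have "\<bar>norm (heat_kernel_grad s (x - y))\<bar> powr (4/3) \<le> (s powr (-3/2)) powr (4/3)"
      using norm_heat_kernel_grad_le[OF s] by (intro powr_mono2) auto
    also have "\<dots> = s powr (-2)" by (simp only: powr_powr) simp
    also have "\<dots> = 1 / s\<^sup>2" using s by (simp add: powr_minus_divide)
    finally show "\<bar>norm (heat_kernel_grad s (x - y))\<bar> powr (4/3) \<le> 1 / s\<^sup>2" .
    assume "x \<notin> ball y (sqrt s)"
    then have z: "x - y \<noteq> 0" using s by auto
    have "\<bar>norm (heat_kernel_grad s (x - y))\<bar> powr (4/3) \<le> (2 / norm (x - y) ^ 3) powr (4/3)"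
      using norm_heat_kernel_grad_decay[OF s z] by (intro powr_mono2) auto
    also have "\<dots> = 2 powr (4/3) / (norm (x - y) powr 3) powr (4/3)"
      using z by (simp add: powr_divide)
    also have "(norm (x - y) powr 3) powr (4/3) = norm (x - y) powr 4" by (simp only: powr_powr) simp
    also have "2 powr (4/3) / norm (x - y) powr 4 \<le> 2 powr 2 / norm (x - y) powr 4"
      by (intro divide_right_mono powr_mono) auto
    also have "\<dots> = 4 / norm (x - y) ^ 4" using z by simp
    finally show "\<bar>norm (heat_kernel_grad s (x - y))\<bar> powr (4/3) \<le> 4 / norm (x - y) ^ 4" .
  qed (use s in auto)
  also have "1 / s\<^sup>2 * (pi * (sqrt s)\<^sup>2) + 4 * (16 * pi / 3 / (sqrt s)\<^sup>2) = 67 * pi / 3 * s powr (-1)"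
    using s by (simp add: powr_minus field_simps power2_eq_square)
  also have "\<dots> = (heat_const * s powr (-3/4)) powr (4/3)"
    using s by (simp add: heat_const_def powr_mult powr_powr)
  finally show ?thesis by (simp add: Lp_le_def)
qed

section \<open>The heat flow of the divergence of an integrable vector field\<close>

lemma heat_distr_div:
  assumes "0 < s"
  shows "heat s (distr_div F) x = - (LINT y|lborel. F y \<bullet> heat_kernel_grad s (x - y))"
  using assms by (simp add: heat_def distr_div_def gradient_heat_kernel)

lemma integrable_heat_distr_div:
  assumes s: "0 < s" and F: "integrable lborel F"
  shows "integrable lborel (\<lambda>y. F y \<bullet> heat_kernel_grad s (x - y))"
proof (rule Bochner_Integration.integrable_bound)
  show "integrable lborel (\<lambda>y. s powr (-3/2) * norm (F y))" using F by simp
  have [measurable]: "F \<in> borel_measurable borel" using F by (auto dest: borel_measurable_integrable)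
  show "(\<lambda>y. F y \<bullet> heat_kernel_grad s (x - y)) \<in> borel_measurable lborel" by measurable
  show "AE y in lborel. norm (F y \<bullet> heat_kernel_grad s (x - y)) \<le> norm (s powr (-3/2) * norm (F y))"
  proof (intro always_eventually allI)
    fix y
    have "norm (F y \<bullet> heat_kernel_grad s (x - y)) \<le> norm (F y) * norm (heat_kernel_grad s (x - y))"
      using Cauchy_Schwarz_ineq2 by simp
    also have "\<dots> \<le> norm (F y) * s powr (-3/2)"
      by (intro mult_left_mono norm_heat_kernel_grad_le s) auto
    finally show "norm (F y \<bullet> heat_kernel_grad s (x - y)) \<le> norm (s powr (-3/2) * norm (F y))"
      by (simp add: mult.commute)
  qed
qed

text \<open>Young's convolution inequality for L^1 and L^(4/3), in dual form: Tonelli moves the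
  integral over \<open>x\<close> inside, where Hoelder applies to the kernel and
  \<open>\<phi>\<close> with a bound independent of \<open>y\<close>; what remains is the L^1 norm
  of \<open>F\<close>.\<close>

lemma heat_distr_div_pairing:
  assumes s: "0 < s" and F: "integrable lborel F"
    and N: "(\<integral>\<^sup>+y. ennreal (norm (F y)) \<partial>lborel) \<le> ennreal N" "0 \<le> N"
    and \<phi>: "Lp_le lborel 4 \<phi> b" and b: "0 < b"
  shows "integrable lborel (\<lambda>x. heat s (distr_div F) x * \<phi> x)" (is ?int)
    and "\<bar>distr_of (heat s (distr_div F)) \<phi>\<bar> \<le> heat_const * s powr (-3/4) * N * b" (is ?bound)
proof -
  have [measurable]: "F \<in> borel_measurable borel" using F by (auto dest: borel_measurable_integrable)
  have [measurable]: "\<phi> \<in> borel_measurable borel" using \<phi> by (simp add: Lp_le_def)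
  define c where "c = heat_const * s powr (-3/4)"
  have c: "0 < c" using s heat_const_pos by (simp add: c_def)
  have Hm: "heat s (distr_div F) \<in> borel_measurable lborel"
    unfolding heat_distr_div[OF s, abs_def] by measurable
  then have [measurable]: "heat s (distr_div F) \<in> borel_measurable borel" by simp
  have "(\<integral>\<^sup>+x. ennreal (norm (heat s (distr_div F) x * \<phi> x)) \<partial>lborel)
     \<le> (\<integral>\<^sup>+x. \<integral>\<^sup>+y. ennreal (norm (F y)) * ennreal (\<bar>norm (heat_kernel_grad s (x - y))\<bar> * \<bar>\<phi> x\<bar>) \<partial>lborel \<partial>lborel)"
  proof (rule nn_integral_mono)
    fix x
    have "ennreal (norm (heat s (distr_div F) x * \<phi> x)) = ennreal (norm (heat s (distr_div F) x)) * ennreal \<bar>\<phi> x\<bar>"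
      by (simp add: abs_mult ennreal_mult')
    also have "\<dots> \<le> (\<integral>\<^sup>+y. ennreal (norm (F y \<bullet> heat_kernel_grad s (x - y))) \<partial>lborel) * ennreal \<bar>\<phi> x\<bar>"
      unfolding heat_distr_div[OF s] norm_minus_cancel
      by (intro mult_right_mono integral_norm_bound_ennreal integrable_heat_distr_div s F) auto
    also have "\<dots> = (\<integral>\<^sup>+y. ennreal (norm (F y \<bullet> heat_kernel_grad s (x - y))) * ennreal \<bar>\<phi> x\<bar> \<partial>lborel)"
      by (rule nn_integral_multc[symmetric]) measurable
    also have "\<dots> \<le> (\<integral>\<^sup>+y. ennreal (norm (F y)) * ennreal (\<bar>norm (heat_kernel_grad s (x - y))\<bar> * \<bar>\<phi> x\<bar>) \<partial>lborel)"
    proof (rule nn_integral_mono)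
      fix y
      have "norm (F y \<bullet> heat_kernel_grad s (x - y)) * \<bar>\<phi> x\<bar> \<le> norm (F y) * norm (heat_kernel_grad s (x - y)) * \<bar>\<phi> x\<bar>"
        using Cauchy_Schwarz_ineq2 by (intro mult_right_mono) auto
      then show "ennreal (norm (F y \<bullet> heat_kernel_grad s (x - y))) * ennreal \<bar>\<phi> x\<bar>
        \<le> ennreal (norm (F y)) * ennreal (\<bar>norm (heat_kernel_grad s (x - y))\<bar> * \<bar>\<phi> x\<bar>)"
        by (simp add: ennreal_mult'[symmetric] mult.assoc ennreal_leI)
    qed
    finally show "ennreal (norm (heat s (distr_div F) x * \<phi> x))
      \<le> (\<integral>\<^sup>+y. ennreal (norm (F y)) * ennreal (\<bar>norm (heat_kernel_grad s (x - y))\<bar> * \<bar>\<phi> x\<bar>) \<partial>lborel)" .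
  qed
  also have "\<dots> = (\<integral>\<^sup>+y. \<integral>\<^sup>+x. ennreal (norm (F y)) * ennreal (\<bar>norm (heat_kernel_grad s (x - y))\<bar> * \<bar>\<phi> x\<bar>) \<partial>lborel \<partial>lborel)"
    by (rule lborel_pair.Fubini'[symmetric]) measurable
  also have "\<dots> \<le> (\<integral>\<^sup>+y. ennreal (norm (F y)) * ennreal (c * b) \<partial>lborel)"
  proof (rule nn_integral_mono)
    fix y
    have "(\<integral>\<^sup>+x. ennreal (norm (F y)) * ennreal (\<bar>norm (heat_kernel_grad s (x - y))\<bar> * \<bar>\<phi> x\<bar>) \<partial>lborel)
      = ennreal (norm (F y)) * (\<integral>\<^sup>+x. ennreal (\<bar>norm (heat_kernel_grad s (x - y))\<bar> * \<bar>\<phi> x\<bar>) \<partial>lborel)"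
      by (rule nn_integral_cmult) measurable
    also have "\<dots> \<le> ennreal (norm (F y)) * ennreal (c * b)"
      using heat_kernel_grad_Lp_le[OF s] c
      by (intro mult_left_mono Holder_nn_integral[OF _ \<phi> _ b]) (auto simp: c_def)
    finally show "(\<integral>\<^sup>+x. ennreal (norm (F y)) * ennreal (\<bar>norm (heat_kernel_grad s (x - y))\<bar> * \<bar>\<phi> x\<bar>) \<partial>lborel)
      \<le> ennreal (norm (F y)) * ennreal (c * b)" .
  qed
  also have "\<dots> = (\<integral>\<^sup>+y. ennreal (norm (F y)) \<partial>lborel) * ennreal (c * b)"
    by (rule nn_integral_multc) measurable
  also have "\<dots> \<le> ennreal N * ennreal (c * b)"
    by (intro mult_right_mono N) auto
  also have "\<dots> = ennreal (c * N * b)"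
    using c b N by (simp add: ennreal_mult'[symmetric] ac_simps)
  finally have le: "(\<integral>\<^sup>+x. ennreal (norm (heat s (distr_div F) x * \<phi> x)) \<partial>lborel) \<le> ennreal (c * N * b)" .
  show int: ?int
    by (rule integrableI_bounded) (measurable, use le in \<open>auto simp: less_top[symmetric] top_unique\<close>)
  have "ennreal (norm (LINT x|lborel. heat s (distr_div F) x * \<phi> x)) \<le> ennreal (c * N * b)"
    using integral_norm_bound_ennreal[OF int] le by (rule order_trans)
  then show ?bound
    using c b N by (simp add: c_def distr_of_def ennreal_le_iff)
qed

lemma heat_distr_div_diff:
  assumes s: "0 < s" and F: "integrable lborel F" and G: "integrable lborel G"
    and \<phi>: "Lp_le lborel 4 \<phi> b" and b: "0 < b"
  shows "distr_of (heat s (distr_div F)) \<phi> - distr_of (heat s (distr_div G)) \<phi>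
    = distr_of (heat s (distr_div (\<lambda>y. F y - G y))) \<phi>"
proof -
  have fin: "\<exists>N\<ge>0. (\<integral>\<^sup>+y. ennreal (norm (F y)) \<partial>lborel) \<le> ennreal N" if "integrable lborel F" for F :: "plane \<Rightarrow> plane"
    using that by (intro exI[of _ "LINT y|lborel. norm (F y)"]) (auto simp: nn_integral_eq_integral)
  have i: "integrable lborel (\<lambda>x. heat s (distr_div F) x * \<phi> x)" if "integrable lborel F" for F
    using fin[OF that] heat_distr_div_pairing(1)[OF s that _ _ \<phi> b] by blast
  have "heat s (distr_div (\<lambda>y. F y - G y)) x = heat s (distr_div F) x - heat s (distr_div G) x" for x
    using integrable_heat_distr_div[OF s F, of x] integrable_heat_distr_div[OF s G, of x]
    by (simp add: heat_distr_div[OF s] inner_diff_left)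
  then show ?thesis
    using i[OF F] i[OF G] by (simp add: distr_of_def left_diff_distrib)
qed

lemma integrable_drift:
  assumes u: "Lp_le lborel (4/3) u a" and a: "0 < a"
  shows "integrable lborel (drift u)"
proof (rule integrableI_bounded)
  have [measurable]: "u \<in> borel_measurable borel" using u by (simp add: Lp_le_def)
  show "drift u \<in> borel_measurable lborel" by measurable
  show "(\<integral>\<^sup>+x. ennreal (norm (drift u x)) \<partial>lborel) < \<infinity>"
    using drift_bound[OF u a] by (auto simp: less_top[symmetric] top_unique)
qed

text \<open>By linearity of the heat flow only the difference of the drifts matters. It is linear in
  the weighted size \<open>m\<close> of u - v and in the common size \<open>e\<close> of the
  solutions; the two factors of order \<tau>^(-1/4) combine to \<tau>^(-1/2).\<close>

lemma duhamel_integrand_diff_bound: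
  assumes \<tau>: "0 < \<tau>" "\<tau> < t" and m: "0 < m" and e: "0 < e"
    and u: "Lp_le lborel (4/3) (Lp_fun (4/3) (u \<tau>)) (e * \<tau> powr (-1/4))"
    and v: "Lp_le lborel (4/3) (Lp_fun (4/3) (v \<tau>)) (e * \<tau> powr (-1/4))"
    and w: "Lp_le lborel (4/3) (\<lambda>x. Lp_fun (4/3) (u \<tau>) x - Lp_fun (4/3) (v \<tau>) x) (m * \<tau> powr (-1/4))"
    and \<phi>: "Lp_le lborel 4 \<phi> b" and b: "0 < b"
  shows "\<bar>duhamel_integrand u t \<tau> \<phi> - duhamel_integrand v t \<tau> \<phi>\<bar>
    \<le> 4 * hls_const * heat_const * e * b * ((t - \<tau>) powr (-3/4) * \<tau> powr (-1/2) * m)"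
proof -
  define U where "U = Lp_fun (4/3) (u \<tau>)"
  define V where "V = Lp_fun (4/3) (v \<tau>)"
  define a where "a = e * \<tau> powr (-1/4)"
  define d where "d = m * \<tau> powr (-1/4)"
  have a: "0 < a" and d: "0 < d" and s: "0 < t - \<tau>" using \<tau> m e by (auto simp: a_def d_def)
  note U = u[folded U_def a_def] and V = v[folded V_def a_def] and W = w[folded U_def V_def d_def]
  have iU: "integrable lborel (drift U)" and iV: "integrable lborel (drift V)"
    using integrable_drift U V a by blast+
  have iW: "integrable lborel (\<lambda>x. drift U x - drift V x)" using iU iV by simp
  have "duhamel_integrand u t \<tau> \<phi> - duhamel_integrand v t \<tau> \<phi>
      = distr_of (heat (t - \<tau>) (distr_div (\<lambda>x. drift U x - drift V x))) \<phi>"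
    unfolding duhamel_integrand_def U_def[symmetric] V_def[symmetric]
    by (rule heat_distr_div_diff[OF s iU iV \<phi> b])
  also have "\<bar>\<dots>\<bar> \<le> heat_const * (t - \<tau>) powr (-3/4) * (4 * hls_const * a * d) * b"
    by (rule heat_distr_div_pairing(2)[OF s iW drift_diff_bound[OF U V a W d] _ \<phi> b])
      (use a d hls_const_pos in auto)
  also have "heat_const * (t - \<tau>) powr (-3/4) * (4 * hls_const * a * d) * b
      = 4 * hls_const * heat_const * e * b * ((t - \<tau>) powr (-3/4) * \<tau> powr (-1/2) * m)"
  proof -
    have "a * d = e * m * \<tau> powr (-1/2)"
      by (simp add: a_def d_def flip: powr_add)
    then show ?thesis by (simp add: mult.assoc)
  qed
  finally show ?thesis .
qed

section \<open>The mild equation\<close>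

lemma nn_integral_powr_Icc:
  fixes T a :: real
  assumes "- 1 < a" "0 \<le> T"
  shows "(\<integral>\<^sup>+\<tau>. ennreal (\<tau> powr a) * indicator {0..T} \<tau> \<partial>lborel) = ennreal (T powr (a + 1) / (a + 1))"
  by (rule nn_integral_has_integral_lebesgue'[OF _ has_integral_powr_from_0]) (use assms in auto)

lemma nn_integral_powr_Icc_reflect:
  fixes t T a :: real
  assumes "- 1 < a" "0 \<le> T"
  shows "(\<integral>\<^sup>+\<tau>. ennreal ((t - \<tau>) powr a) * indicator {t - T..t} \<tau> \<partial>lborel) = ennreal (T powr (a + 1) / (a + 1))"
proof -
  have "(\<integral>\<^sup>+\<tau>. ennreal ((t - \<tau>) powr a) * indicator {t - T..t} \<tau> \<partial>lborel)
     = (\<integral>\<^sup>+\<tau>. ennreal ((t - (t + (- 1) * \<tau>)) powr a) * indicator {t - T..t} (t + (- 1) * \<tau>) \<partial>lborel)"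
    by (subst nn_integral_real_affine[where c = "- 1" and t = t]) auto
  also have "\<dots> = (\<integral>\<^sup>+\<tau>. ennreal (\<tau> powr a) * indicator {0..T} \<tau> \<partial>lborel)"
    by (intro nn_integral_cong) (auto simp: indicator_def)
  finally show ?thesis using nn_integral_powr_Icc[OF assms] by simp
qed

text \<open>The two singularities are separated at t/2: before it (t - \<tau>)^(-3/4), after it
  \<tau>^(-1/2) is bounded by its value at t/2. The parts with \<open>L\<close> give 2 + 4 = 6 times
  (t/2)^(-1/4). The part with \<open>M\<close> lives on bounded times and decays like t^(-3/4),
  which is negligible against t^(-1/4).\<close>

lemma duhamel_kernel_bound:
  fixes t T M L :: real
  assumes T: "0 \<le> T" "2 * T \<le> t" and t: "0 < t" and M: "0 \<le> M" and L: "0 \<le> L"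
  shows "(\<integral>\<^sup>+\<tau>. ennreal (indicator {0<..<t} \<tau> * ((t - \<tau>) powr (-3/4) * \<tau> powr (-1/2) * (if \<tau> \<le> T then M else L))) \<partial>lborel)
    \<le> ennreal (M * ((t/2) powr (-3/4) * (2 * T powr (1/2))) + L * (6 * (t/2) powr (-1/4)))"
proof -
  define p where "p = (t/2) powr (-3/4)"
  define r where "r = (t/2) powr (-1/2)"
  have p: "0 \<le> p" and r: "0 \<le> r" by (auto simp: p_def r_def)
  have early: "(t - \<tau>) powr (-3/4) * \<tau> powr (-1/2) \<le> p * \<tau> powr (-1/2)" if "0 < \<tau>" "\<tau> \<le> t/2" for \<tau>
    unfolding p_def using that by (intro mult_right_mono powr_mono2') auto
  have late: "(t - \<tau>) powr (-3/4) * \<tau> powr (-1/2) \<le> (t - \<tau>) powr (-3/4) * r" if "t/2 \<le> \<tau>" for \<tau>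
    unfolding r_def using that t by (intro mult_left_mono powr_mono2') auto
  let ?I = "\<lambda>\<tau>. ennreal (M * p) * (ennreal (\<tau> powr (-1/2)) * indicator {0..T} \<tau>)
     + (ennreal (L * p) * (ennreal (\<tau> powr (-1/2)) * indicator {0..t/2} \<tau>)
     + ennreal (L * r) * (ennreal ((t - \<tau>) powr (-3/4)) * indicator {t - t/2..t} \<tau>))"
  have "(\<integral>\<^sup>+\<tau>. ennreal (indicator {0<..<t} \<tau> * ((t - \<tau>) powr (-3/4) * \<tau> powr (-1/2) * (if \<tau> \<le> T then M else L))) \<partial>lborel)
    \<le> (\<integral>\<^sup>+\<tau>. ?I \<tau> \<partial>lborel)"
  proof (rule nn_integral_mono)
    fix \<tau> :: real
    show "ennreal (indicator {0<..<t} \<tau> * ((t - \<tau>) powr (-3/4) * \<tau> powr (-1/2) * (if \<tau> \<le> T then M else L))) \<le> ?I \<tau>"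
    proof (cases "0 < \<tau> \<and> \<tau> < t")
      case True
      consider "\<tau> \<le> T" | "T < \<tau>" "\<tau> \<le> t/2" | "T < \<tau>" "t/2 < \<tau>" by linarith
      then show ?thesis
      proof cases
        case 1
        have "(t - \<tau>) powr (-3/4) * \<tau> powr (-1/2) * M \<le> p * \<tau> powr (-1/2) * M"
          using 1 T True M by (intro mult_right_mono early) auto
        then have "ennreal ((t - \<tau>) powr (-3/4) * \<tau> powr (-1/2) * M) \<le> ennreal (M * p) * ennreal (\<tau> powr (-1/2))"
          using M p by (simp add: ennreal_mult'[symmetric] ac_simps ennreal_leI)
        then show ?thesis using 1 True by (intro add_increasing2) auto
      next
        case 2
        have "(t - \<tau>) powr (-3/4) * \<tau> powr (-1/2) * L \<le> p * \<tau> powr (-1/2) * L"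
          using 2 True L by (intro mult_right_mono early) auto
        then have "ennreal ((t - \<tau>) powr (-3/4) * \<tau> powr (-1/2) * L) \<le> ennreal (L * p) * ennreal (\<tau> powr (-1/2))"
          using L p by (simp add: ennreal_mult'[symmetric] ac_simps ennreal_leI)
        then show ?thesis using 2 True by (intro add_increasing add_increasing2) auto
      next
        case 3
        have "(t - \<tau>) powr (-3/4) * \<tau> powr (-1/2) * L \<le> (t - \<tau>) powr (-3/4) * r * L"
          using 3 True L by (intro mult_right_mono late) auto
        then have "ennreal ((t - \<tau>) powr (-3/4) * \<tau> powr (-1/2) * L) \<le> ennreal (L * r) * ennreal ((t - \<tau>) powr (-3/4))"
          using L r by (simp add: ennreal_mult'[symmetric] ac_simps ennreal_leI)
        then show ?thesis using 3 True by (intro add_increasing) auto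
      qed
    qed (auto simp: indicator_def)
  qed
  also have "\<dots> = ennreal (M * p) * ennreal (T powr (1/2) / (1/2))
     + (ennreal (L * p) * ennreal ((t/2) powr (1/2) / (1/2)) + ennreal (L * r) * ennreal ((t/2) powr (1/4) / (1/4)))"
    using nn_integral_powr_Icc[of "-1/2" T] nn_integral_powr_Icc[of "-1/2" "t/2"]
      nn_integral_powr_Icc_reflect[of "-3/4" "t/2" t] T t
    by (simp add: nn_integral_add nn_integral_cmult)
  also have "\<dots> = ennreal (M * p * (2 * T powr (1/2)) + L * (2 * (p * (t/2) powr (1/2)) + 4 * (r * (t/2) powr (1/4))))"
    using M L p r by (simp add: ennreal_mult'[symmetric] ennreal_plus[symmetric] algebra_simps del: ennreal_plus)
  also have "p * (t/2) powr (1/2) = (t/2) powr (-1/4)" by (simp add: p_def flip: powr_add)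
  also have "r * (t/2) powr (1/4) = (t/2) powr (-1/4)" by (simp add: r_def flip: powr_add)
  finally show ?thesis by (simp add: p_def mult.assoc)
qed

section \<open>Functions representing distributions, and the norms of such distributions\<close>

lemma Lp_fun_Lp_distr:
  assumes "T \<in> Lp_distr p"
  shows "Lp_fun p T \<in> Lp p" "represents (Lp_fun p T) T"
proof -
  have "\<exists>g. g \<in> Lp p \<and> represents g T" using assms by (auto simp: Lp_distr_def)
  from someI_ex[OF this] show "Lp_fun p T \<in> Lp p" "represents (Lp_fun p T) T"
    unfolding Lp_fun_def by auto
qed

lemma Lp_diff:
  assumes "f \<in> Lp p" "g \<in> Lp p" "1 \<le> p"
  shows "(\<lambda>x. f x - g x) \<in> Lp p" "Lp_norm p (\<lambda>x. f x - g x) \<le> Lp_norm p f + Lp_norm p g"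
proof -
  \<comment> \<open>The increment \<open>e\<close> makes both bounds positive even if a norm
    vanishes; it is removed in the limit.\<close>
  have le: "Lp_le lborel p (\<lambda>x. f x - g x) ((Lp_norm p f + e) + (Lp_norm p g + e))" if e: "0 < e" for e
    using assms e Lp_norm_nonneg[of p f] Lp_norm_nonneg[of p g]
    by (intro Lp_le_diff Lp_le_of_Lp) auto
  show "(\<lambda>x. f x - g x) \<in> Lp p"
    using Lp_of_Lp_le(1)[OF le[of 1]] assms Lp_norm_nonneg[of p f] Lp_norm_nonneg[of p g] by simp
  show "Lp_norm p (\<lambda>x. f x - g x) \<le> Lp_norm p f + Lp_norm p g"
  proof (rule field_le_epsilon)
    fix e :: real assume "0 < e"
    then show "Lp_norm p (\<lambda>x. f x - g x) \<le> Lp_norm p f + Lp_norm p g + e"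
      using Lp_of_Lp_le(2)[OF le[of "e/2"]] assms Lp_norm_nonneg[of p f] Lp_norm_nonneg[of p g] by simp
  qed
qed

lemma Lp_pairing:
  assumes f: "f \<in> Lp (4/3)" and \<phi>: "Lp_le lborel 4 \<phi> b" and b: "0 < b"
  shows "integrable lborel (\<lambda>x. f x * \<phi> x)" "\<bar>LINT x|lborel. f x * \<phi> x\<bar> \<le> Lp_norm (4/3) f * b"
proof -
  have le: "Lp_le lborel (4/3) f (Lp_norm (4/3) f + e)" if "0 < e" for e
    using f that by (intro Lp_le_of_Lp) auto
  have pos: "0 < Lp_norm (4/3) f + e" if "0 < e" for e
    using Lp_norm_nonneg[of "4/3" f] that by linarith
  show "integrable lborel (\<lambda>x. f x * \<phi> x)"
    by (rule Holder_integrable(1)[OF le[of 1] \<phi> pos[of 1] b]) auto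
  show "\<bar>LINT x|lborel. f x * \<phi> x\<bar> \<le> Lp_norm (4/3) f * b"
  proof (rule field_le_epsilon)
    fix e :: real assume e: "0 < e"
    then have e': "0 < e / b" using b by simp
    have "\<bar>LINT x|lborel. f x * \<phi> x\<bar> \<le> (Lp_norm (4/3) f + e / b) * b"
      by (rule Holder_integrable(2)[OF le[OF e'] \<phi> pos[OF e'] b]) auto
    then show "\<bar>LINT x|lborel. f x * \<phi> x\<bar> \<le> Lp_norm (4/3) f * b + e"
      using b by (simp add: distrib_right)
  qed
qed

lemma distr_of_diff:
  assumes "f \<in> Lp (4/3)" "g \<in> Lp (4/3)" "Lp_le lborel 4 \<phi> b" "0 < b"
  shows "distr_of (\<lambda>x. f x - g x) \<phi> = distr_of f \<phi> - distr_of g \<phi>"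
  using Lp_pairing(1)[OF assms(1,3,4)] Lp_pairing(1)[OF assms(2,3,4)]
  by (simp add: distr_of_def left_diff_distrib)

lemma represents_diff:
  assumes "f \<in> Lp (4/3)" "g \<in> Lp (4/3)" "represents f S" "represents g T"
  shows "represents (\<lambda>x. f x - g x) (S - T)"
  unfolding represents_def
proof
  fix \<phi> assume \<phi>: "\<phi> \<in> schwartz"
  then obtain b where "0 < b" "Lp_le lborel 4 \<phi> b" using schwartz_Lp_le_4 by blast
  then show "(S - T) \<phi> = distr_of (\<lambda>x. f x - g x) \<phi>"
    using assms \<phi> distr_of_diff[OF assms(1,2)] by (simp add: represents_def)
qed

text \<open>Duality computes the norm from the pairings with Schwartz functions, and these depend
  only on the distribution. So the arbitrary choice in \<open>Lp_fun\<close> does not affect the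
  norm, and equality almost everywhere of two representatives never has to be discussed.\<close>

lemma Lp_norm_unique:
  assumes "f \<in> Lp (4/3)" "g \<in> Lp (4/3)" "represents f T" "represents g T"
  shows "Lp_norm (4/3) f = Lp_norm (4/3) g"
proof -
  have le: "Lp_norm (4/3) f \<le> Lp_norm (4/3) g"
    if "f \<in> Lp (4/3)" "g \<in> Lp (4/3)" "represents f T" "represents g T" for f g
  proof (rule Lp_le_by_duality[OF that(1) Lp_norm_nonneg])
    fix \<phi> b assume \<phi>: "\<phi> \<in> schwartz" "0 < b" "Lp_le lborel 4 \<phi> b"
    then have "(LINT x|lborel. f x * \<phi> x) = (LINT x|lborel. g x * \<phi> x)"
      using that by (simp add: represents_def distr_of_def)
    then show "\<bar>LINT x|lborel. f x * \<phi> x\<bar> \<le> Lp_norm (4/3) g * b"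
      using Lp_pairing(2)[OF that(2) \<phi>(3,2)] by simp
  qed
  from le[OF assms] le[OF assms(2,1,4,3)] show ?thesis by simp
qed

lemma Lp_distr_diff:
  assumes "S \<in> Lp_distr (4/3)" "T \<in> Lp_distr (4/3)"
  shows "S - T \<in> Lp_distr (4/3)"
    and "Lp_distr_norm (4/3) (S - T) = Lp_norm (4/3) (\<lambda>x. Lp_fun (4/3) S x - Lp_fun (4/3) T x)"
proof -
  note S = Lp_fun_Lp_distr[OF assms(1)] and T = Lp_fun_Lp_distr[OF assms(2)]
  have d: "(\<lambda>x. Lp_fun (4/3) S x - Lp_fun (4/3) T x) \<in> Lp (4/3)" using S T by (intro Lp_diff) auto
  have r: "represents (\<lambda>x. Lp_fun (4/3) S x - Lp_fun (4/3) T x) (S - T)" by (intro represents_diff S T)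
  show *: "S - T \<in> Lp_distr (4/3)" using d r by (auto simp: Lp_distr_def)
  show "Lp_distr_norm (4/3) (S - T) = Lp_norm (4/3) (\<lambda>x. Lp_fun (4/3) S x - Lp_fun (4/3) T x)"
    unfolding Lp_distr_norm_def using Lp_norm_unique[OF Lp_fun_Lp_distr(1)[OF *] d Lp_fun_Lp_distr(2)[OF *] r] .
qed

section \<open>Comparison of two small mild solutions\<close>

lemma small_mild_solution_bound:
  assumes "small_mild_solution \<epsilon> u0 u" "0 < t"
  shows "u t \<in> Lp_distr (4/3)" "t powr (1/4) * Lp_distr_norm (4/3) (u t) \<le> 2 * \<epsilon>"
proof -
  have X: "u \<in> X_space u0" and sup: "(SUP t\<in>{0<..}. t powr (1/4) * Lp_distr_norm (4/3) (u t)) < 2 * \<epsilon>"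
    using assms by (auto simp: small_mild_solution_def)
  show "u t \<in> Lp_distr (4/3)" using X assms by (auto simp: X_space_def)
  have "t powr (1/4) * Lp_distr_norm (4/3) (u t) \<le> (SUP t\<in>{0<..}. t powr (1/4) * Lp_distr_norm (4/3) (u t))"
    using X assms by (intro cSUP_upper) (auto simp: X_space_def)
  with sup show "t powr (1/4) * Lp_distr_norm (4/3) (u t) \<le> 2 * \<epsilon>" by linarith
qed

lemma le_powr_minus_quarter:
  fixes t x c :: real
  assumes "0 < t" "t powr (1/4) * x \<le> c"
  shows "x \<le> c * t powr (-1/4)"
proof -
  have "t powr (-1/4) * (t powr (1/4) * x) \<le> t powr (-1/4) * c"
    using assms by (intro mult_left_mono) auto
  also have "t powr (-1/4) * (t powr (1/4) * x) = x"
    using assms by (simp add: mult.assoc[symmetric] flip: powr_add)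
  finally show ?thesis by (simp add: mult.commute)
qed

lemma small_mild_solutions_diff_bound:
  assumes "small_mild_solution \<epsilon> u0 u" "small_mild_solution \<epsilon> v0 v" "0 < t"
  shows "t powr (1/4) * Lp_distr_norm (4/3) (u t - v t) \<le> 4 * \<epsilon>"
proof -
  note u = small_mild_solution_bound[OF assms(1,3)] and v = small_mild_solution_bound[OF assms(2,3)]
  have "Lp_distr_norm (4/3) (u t - v t) \<le> Lp_distr_norm (4/3) (u t) + Lp_distr_norm (4/3) (v t)"
    unfolding Lp_distr_diff(2)[OF u(1) v(1)]
    unfolding Lp_distr_norm_def by (intro Lp_diff(2) Lp_fun_Lp_distr u v) auto
  then have "t powr (1/4) * Lp_distr_norm (4/3) (u t - v t)
     \<le> t powr (1/4) * (Lp_distr_norm (4/3) (u t) + Lp_distr_norm (4/3) (v t))"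
    by (rule mult_left_mono) simp
  then show ?thesis using u(2) v(2) by (simp add: distrib_left)
qed

text \<open>The factor 8 is 4 from the bilinear drift estimate times 2 from the bound
  \<open>2 * \<epsilon>\<close> on the solutions.\<close>

definition debye_const :: real where
  "debye_const = 8 * hls_const * heat_const"

lemma debye_const_pos: "0 < debye_const"
  using hls_const_pos heat_const_pos by (simp add: debye_const_def)

text \<open>The two mild identities are subtracted while still paired with a test function. The
  resulting estimate is proportional to the L^4 bound of the test function, so duality turns it into
  a comparison of norms. Two values of the majorant, one up to \<open>T\<close> and one after, keep
  the norm of u - v out of the integrand.\<close>

lemma duhamel_difference_bound:
  assumes u0: "u0 \<in> BX" and v0: "v0 \<in> BX" and u: "small_mild_solution \<epsilon> u0 u" and v: "small_mild_solution \<epsilon> v0 v"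
    and \<epsilon>: "0 < \<epsilon>" and T: "0 < T" "2 * T \<le> t" and L: "0 < L"
    and late: "\<And>\<tau>. T < \<tau> \<Longrightarrow> \<tau> powr (1/4) * Lp_distr_norm (4/3) (u \<tau> - v \<tau>) \<le> L"
  shows "\<bar>Lp_distr_norm (4/3) (u t - v t) - Lp_norm (4/3) (heat t (u0 - v0))\<bar>
    \<le> debye_const * \<epsilon> * (4 * \<epsilon> * ((t/2) powr (-3/4) * (2 * T powr (1/2))) + L * (6 * (t/2) powr (-1/4)))"
proof -
  have t: "0 < t" using T by linarith
  define E where "E = 4 * \<epsilon> * ((t/2) powr (-3/4) * (2 * T powr (1/2))) + L * (6 * (t/2) powr (-1/4))"
  have E: "0 \<le> E" using \<epsilon> L by (simp add: E_def)
  define A where "A = debye_const * \<epsilon> * E"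
  have A: "0 \<le> A" using E \<epsilon> debye_const_pos by (simp add: A_def)
  define g where "g = Lp_fun (4/3) (u t - v t)"
  define h where "h x = heat t u0 x - heat t v0 x" for x
  note ut = small_mild_solution_bound(1)[OF u t] and vt = small_mild_solution_bound(1)[OF v t]
  have g: "g \<in> Lp (4/3)" "represents g (u t - v t)"
    unfolding g_def by (intro Lp_fun_Lp_distr Lp_distr_diff ut vt)+
  have hu: "heat t u0 \<in> Lp (4/3)" and hv: "heat t v0 \<in> Lp (4/3)"
    using u0 v0 t by (auto simp: BX_def)
  have h: "h \<in> Lp (4/3)" unfolding h_def using hu hv by (intro Lp_diff) auto
  have heat_h: "heat t (u0 - v0) = h" by (auto simp: heat_def h_def)
  have main: "\<bar>distr_of g \<phi> - distr_of h \<phi>\<bar> \<le> A * b"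
    if \<phi>: "\<phi> \<in> schwartz" "0 < b" "Lp_le lborel 4 \<phi> b" for \<phi> b
  proof -
    let ?d = "\<lambda>\<tau>. duhamel_integrand u t \<tau> \<phi> - duhamel_integrand v t \<tau> \<phi>"
    have mu: "set_integrable lebesgue {0<..<t} (\<lambda>\<tau>. duhamel_integrand u t \<tau> \<phi>)"
      "u t \<phi> = distr_of (heat t u0) \<phi> + (LINT \<tau>:{0<..<t}|lebesgue. duhamel_integrand u t \<tau> \<phi>)"
      using u t \<phi> by (auto simp: small_mild_solution_def mild_solution_def)
    have mv: "set_integrable lebesgue {0<..<t} (\<lambda>\<tau>. duhamel_integrand v t \<tau> \<phi>)"
      "v t \<phi> = distr_of (heat t v0) \<phi> + (LINT \<tau>:{0<..<t}|lebesgue. duhamel_integrand v t \<tau> \<phi>)"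
      using v t \<phi> by (auto simp: small_mild_solution_def mild_solution_def)
    have "distr_of g \<phi> - distr_of h \<phi> = (u t \<phi> - v t \<phi>) - (distr_of (heat t u0) \<phi> - distr_of (heat t v0) \<phi>)"
      using g(2) \<phi> distr_of_diff[OF hu hv \<phi>(3,2)] by (simp add: represents_def h_def[abs_def])
    also have "\<dots> = (LINT \<tau>:{0<..<t}|lebesgue. ?d \<tau>)"
      by (simp add: mu(2) mv(2) set_integral_diff(2)[OF mu(1) mv(1)])
    finally have eq: "distr_of g \<phi> - distr_of h \<phi> = (LINT \<tau>:{0<..<t}|lebesgue. ?d \<tau>)" .
    define c where "c = debye_const * \<epsilon> * b"
    have c: "0 < c" using \<epsilon> \<phi> debye_const_pos by (simp add: c_def)
    \<comment> \<open>Up to \<open>T\<close> only the triangle inequality is available, giving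
      2\<epsilon> + 2\<epsilon>; after \<open>T\<close> the assumed bound \<open>L\<close> takes
      over.\<close>
    let ?k = "\<lambda>\<tau>. indicator {0<..<t} \<tau> * ((t - \<tau>) powr (-3/4) * \<tau> powr (-1/2) * (if \<tau> \<le> T then 4 * \<epsilon> else L))"
    have pw: "\<bar>?d \<tau>\<bar> \<le> c * ((t - \<tau>) powr (-3/4) * \<tau> powr (-1/2) * (if \<tau> \<le> T then 4 * \<epsilon> else L))"
      if \<tau>: "0 < \<tau>" "\<tau> < t" for \<tau>
    proof -
      define m where "m = (if \<tau> \<le> T then 4 * \<epsilon> else L)"
      note u\<tau> = small_mild_solution_bound[OF u \<tau>(1)] and v\<tau> = small_mild_solution_bound[OF v \<tau>(1)]
      have "\<tau> powr (1/4) * Lp_distr_norm (4/3) (u \<tau> - v \<tau>) \<le> m"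
        using late[of \<tau>] small_mild_solutions_diff_bound[OF u v \<tau>(1)] by (auto simp: m_def)
      then have w: "Lp_norm (4/3) (\<lambda>x. Lp_fun (4/3) (u \<tau>) x - Lp_fun (4/3) (v \<tau>) x) \<le> m * \<tau> powr (-1/4)"
        using le_powr_minus_quarter[OF \<tau>(1)] by (simp only: Lp_distr_diff(2)[OF u\<tau>(1) v\<tau>(1)])
      have "\<bar>?d \<tau>\<bar> \<le> 4 * hls_const * heat_const * (2 * \<epsilon>) * b * ((t - \<tau>) powr (-3/4) * \<tau> powr (-1/2) * m)"
      proof (rule duhamel_integrand_diff_bound[OF \<tau> _ _ _ _ _ \<phi>(3,2)])
        show "0 < m" "0 < 2 * \<epsilon>" using \<epsilon> L by (auto simp: m_def)
        show "Lp_le lborel (4/3) (Lp_fun (4/3) (u \<tau>)) (2 * \<epsilon> * \<tau> powr (-1/4))"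
          using le_powr_minus_quarter[OF \<tau>(1) u\<tau>(2)] Lp_fun_Lp_distr(1)[OF u\<tau>(1)]
          by (intro Lp_le_of_Lp) (auto simp: Lp_distr_norm_def)
        show "Lp_le lborel (4/3) (Lp_fun (4/3) (v \<tau>)) (2 * \<epsilon> * \<tau> powr (-1/4))"
          using le_powr_minus_quarter[OF \<tau>(1) v\<tau>(2)] Lp_fun_Lp_distr(1)[OF v\<tau>(1)]
          by (intro Lp_le_of_Lp) (auto simp: Lp_distr_norm_def)
        show "Lp_le lborel (4/3) (\<lambda>x. Lp_fun (4/3) (u \<tau>) x - Lp_fun (4/3) (v \<tau>) x) (m * \<tau> powr (-1/4))"
          using Lp_fun_Lp_distr(1)[OF u\<tau>(1)] Lp_fun_Lp_distr(1)[OF v\<tau>(1)]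
          by (intro Lp_le_of_Lp Lp_diff(1) w) auto
      qed
      then show ?thesis by (simp add: c_def debye_const_def m_def mult.assoc)
    qed
    have int: "integrable lebesgue (\<lambda>\<tau>. indicator {0<..<t} \<tau> *\<^sub>R ?d \<tau>)"
      using set_integral_diff(1)[OF mu(1) mv(1)] by (simp only: set_integrable_def)
    have "ennreal (norm (LINT \<tau>:{0<..<t}|lebesgue. ?d \<tau>))
       \<le> (\<integral>\<^sup>+\<tau>. ennreal (norm (indicator {0<..<t} \<tau> *\<^sub>R ?d \<tau>)) \<partial>lebesgue)"
      unfolding set_lebesgue_integral_def by (rule integral_norm_bound_ennreal[OF int])
    also have "\<dots> \<le> (\<integral>\<^sup>+\<tau>. ennreal c * ennreal (?k \<tau>) \<partial>lebesgue)"
    proof (rule nn_integral_mono)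
      fix \<tau> :: real
      have "norm (indicator {0<..<t} \<tau> *\<^sub>R ?d \<tau>) \<le> c * ?k \<tau>"
      proof (cases "\<tau> \<in> {0<..<t}")
        case True
        then have "0 < \<tau>" "\<tau> < t" by auto
        from pw[OF this] show ?thesis
          by (simp only: indicator_simps(1)[OF True] scaleR_one real_norm_def mult_1)
      next
        case False
        then show ?thesis
          by (simp only: indicator_simps(2) scaleR_zero_left norm_zero mult_zero_left mult_zero_right order_refl
              not_False_eq_True)
      qed
      then show "ennreal (norm (indicator {0<..<t} \<tau> *\<^sub>R ?d \<tau>)) \<le> ennreal c * ennreal (?k \<tau>)"
        using c by (simp add: ennreal_mult'[symmetric] ennreal_leI)
    qed
    also have "\<dots> = (\<integral>\<^sup>+\<tau>. ennreal c * ennreal (?k \<tau>) \<partial>lborel)"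
      by (rule nn_integral_completion)
    also have "\<dots> = ennreal c * (\<integral>\<^sup>+\<tau>. ennreal (?k \<tau>) \<partial>lborel)"
      by (rule nn_integral_cmult) measurable
    also have "\<dots> \<le> ennreal c * ennreal E"
      unfolding E_def using T \<epsilon> L t by (intro mult_left_mono duhamel_kernel_bound) auto
    also have "\<dots> = ennreal (A * b)"
      using c E by (simp add: ennreal_mult'[symmetric] A_def c_def ac_simps)
    finally show ?thesis
      unfolding eq using A \<phi>(2) by (simp add: ennreal_le_iff)
  qed
  \<comment> \<open>Since the pairings of \<open>g\<close> and \<open>h\<close> differ by at most A
    b, each norm is bounded by the other plus \<open>A\<close>. Both directions are needed: one for
    each implication of the equivalence.\<close>
  have "Lp_norm (4/3) g \<le> Lp_norm (4/3) h + A"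
  proof (rule Lp_le_by_duality[OF g(1)])
    fix \<phi> b assume \<phi>: "\<phi> \<in> schwartz" "0 < b" "Lp_le lborel 4 \<phi> b"
    show "\<bar>LINT x|lborel. g x * \<phi> x\<bar> \<le> (Lp_norm (4/3) h + A) * b"
      using main[OF \<phi>] Lp_pairing(2)[OF h \<phi>(3,2)] by (simp add: distr_of_def distrib_right)
  qed (use A Lp_norm_nonneg in auto)
  moreover have "Lp_norm (4/3) h \<le> Lp_norm (4/3) g + A"
  proof (rule Lp_le_by_duality[OF h])
    fix \<phi> b assume \<phi>: "\<phi> \<in> schwartz" "0 < b" "Lp_le lborel 4 \<phi> b"
    show "\<bar>LINT x|lborel. h x * \<phi> x\<bar> \<le> (Lp_norm (4/3) g + A) * b"
      using main[OF \<phi>] Lp_pairing(2)[OF g(1) \<phi>(3,2)] by (simp add: distr_of_def distrib_right)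
  qed (use A Lp_norm_nonneg in auto)
  ultimately show ?thesis
    unfolding heat_h Lp_distr_norm_def g_def[symmetric] A_def[symmetric] E_def[symmetric] by linarith
qed

text \<open>If \<open>h\<close> tends to 0, then any small \<open>L\<close> is eventually a bound
  and \<open>H\<close> is close to \<open>h\<close>. Conversely, each eventual bound
  \<open>L\<close> of \<open>h\<close> can be lowered: the Duhamel term costs little more than L/2,
  and \<open>H\<close> becomes arbitrarily small. Iterating from the global bound drives
  \<open>h\<close> to 0.\<close>

lemma tendsto_zero_iff_contraction:
  fixes h H :: "real \<Rightarrow> real"
  assumes nonneg: "\<And>t. 0 \<le> h t" "\<And>t. 0 \<le> H t" and bdd: "\<And>t. 0 < t \<Longrightarrow> h t \<le> M"
    and step: "\<And>T L \<delta>. 0 < T \<Longrightarrow> 0 < L \<Longrightarrow> 0 < \<delta> \<Longrightarrow> (\<And>\<tau>. T < \<tau> \<Longrightarrow> h \<tau> \<le> L) \<Longrightarrow>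
      eventually (\<lambda>t. \<bar>h t - H t\<bar> \<le> \<delta> + L / 2) at_top"
  shows "(H \<longlongrightarrow> 0) at_top \<longleftrightarrow> (h \<longlongrightarrow> 0) at_top"
proof -
  have step': "eventually (\<lambda>t. \<bar>h t - H t\<bar> \<le> \<delta> + L / 2) at_top"
    if ev: "eventually (\<lambda>t. h t \<le> L) at_top" and pos: "0 < L" "0 < \<delta>" for L \<delta>
  proof -
    obtain T where T: "\<And>t. T \<le> t \<Longrightarrow> h t \<le> L" using ev by (auto simp: eventually_at_top_linorder)
    show ?thesis by (rule step[of "max T 1"]) (use T pos in auto)
  qed
  have small: "eventually (\<lambda>t. f t < e) at_top" if "(f \<longlongrightarrow> 0) at_top" "0 < e" for f :: "real \<Rightarrow> real" and e
    using order_tendstoD(2)[OF that(1), of e] that by simp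
  show ?thesis
  proof
    assume h: "(h \<longlongrightarrow> 0) at_top"
    show "(H \<longlongrightarrow> 0) at_top"
    proof (rule order_tendstoI)
      fix a :: real assume "a < 0"
      then show "eventually (\<lambda>t. a < H t) at_top"
        using nonneg(2) by (auto intro: always_eventually less_le_trans)
    next
      fix e :: real assume e: "0 < e"
      have s: "eventually (\<lambda>t. h t < e / 4) at_top" using small[OF h, of "e / 4"] e by simp
      then have "eventually (\<lambda>t. h t \<le> e / 4) at_top" by (rule eventually_mono) simp
      then have "eventually (\<lambda>t. \<bar>h t - H t\<bar> \<le> e / 4 + e / 4 / 2) at_top"
        by (rule step') (use e in auto)
      with s show "eventually (\<lambda>t. H t < e) at_top"
      proof eventually_elim
        case (elim t)
        then show ?case using e abs_ge_minus_self[of "h t - H t"] by linarith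
      qed
    qed
  next
    assume H: "(H \<longlongrightarrow> 0) at_top"
    \<comment> \<open>The maximum keeps every bound in the iteration strictly positive, as
      \<open>step'\<close> requires.\<close>
    define M' where "M' = max M 1"
    have M': "0 < M'" by (simp add: M'_def)
    have iter: "eventually (\<lambda>t. h t \<le> M' * (3/4) ^ n) at_top" for n
    proof (induction n)
      case 0
      have "eventually (\<lambda>t::real. 0 < t) at_top" by (rule eventually_gt_at_top)
      then show ?case
        by (rule eventually_mono) (use bdd in \<open>force simp: M'_def intro: order_trans\<close>)
    next
      case (Suc n)
      define L where "L = M' * (3/4) ^ n"
      have L: "0 < L" using M' by (simp add: L_def)
      \<comment> \<open>The factor 3/4 is 1/2 from the contraction, 1/8 from the error
        \<open>\<delta>\<close> and 1/8 from the eventual smallness of \<open>H\<close>.\<close>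
      have "eventually (\<lambda>t. \<bar>h t - H t\<bar> \<le> L / 8 + L / 2) at_top"
        by (rule step') (use Suc L in \<open>auto simp: L_def\<close>)
      moreover have "eventually (\<lambda>t. H t < L / 8) at_top" using small[OF H, of "L / 8"] L by simp
      ultimately have "eventually (\<lambda>t. h t \<le> L * (3/4)) at_top"
      proof eventually_elim
        case (elim t)
        then show ?case using abs_ge_self[of "h t - H t"] by linarith
      qed
      moreover have "L * (3/4) = M' * (3/4) ^ Suc n" by (simp add: L_def)
      ultimately show ?case by (simp only:)
    qed
    show "(h \<longlongrightarrow> 0) at_top"
    proof (rule order_tendstoI)
      fix a :: real assume "a < 0"
      then show "eventually (\<lambda>t. a < h t) at_top"
        using nonneg(1) by (auto intro: always_eventually less_le_trans)
    next
      fix e :: real assume e: "0 < e"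
      have "(\<lambda>n. M' * (3/4) ^ n) \<longlonglongrightarrow> M' * 0" by (intro tendsto_intros LIMSEQ_realpow_zero) auto
      then have "eventually (\<lambda>n. M' * (3/4) ^ n < e) sequentially"
        using e by (intro order_tendstoD) auto
      then obtain n where "M' * (3/4) ^ n < e" by (auto simp: eventually_sequentially)
      with iter[of n] show "eventually (\<lambda>t. h t < e) at_top"
        by (auto elim: eventually_mono)
    qed
  qed
qed

theorem theorem5p2:
  shows "\<exists>\<epsilon>\<^sub>0>0. \<forall>\<epsilon>. 0 < \<epsilon> \<and> \<epsilon> \<le> \<epsilon>\<^sub>0 \<longrightarrow>
    (\<forall>u\<^sub>0 v\<^sub>0 u v.
       u\<^sub>0 \<in> BX \<and> v\<^sub>0 \<in> BX \<and> BX_norm u\<^sub>0 < \<epsilon> \<and> BX_norm v\<^sub>0 < \<epsilon> \<and>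
       small_mild_solution \<epsilon> u\<^sub>0 u \<and> small_mild_solution \<epsilon> v\<^sub>0 v \<longrightarrow>
       (((\<lambda>t. t powr (1/4) * Lp_norm (4/3) (heat t (u\<^sub>0 - v\<^sub>0))) \<longlongrightarrow> 0) at_top \<longleftrightarrow>
        ((\<lambda>t. t powr (1/4) * Lp_distr_norm (4/3) (u t - v t)) \<longlongrightarrow> 0) at_top))"
proof (intro exI[of _ "1 / (24 * debye_const)"] conjI allI impI, goal_cases)
  case 1
  then show ?case using debye_const_pos by simp
next
  case (2 \<epsilon> u0 v0 u v)
  then have \<epsilon>: "0 < \<epsilon>" "\<epsilon> \<le> 1 / (24 * debye_const)" and u0: "u0 \<in> BX" and v0: "v0 \<in> BX"
    and u: "small_mild_solution \<epsilon> u0 u" and v: "small_mild_solution \<epsilon> v0 v" by auto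
  define K where "K = debye_const * \<epsilon>"
  \<comment> \<open>The threshold for \<open>\<epsilon>\<close> is chosen for this: 12 is the 6 of
    the Duhamel kernel times 2, the latter bounding (1/2)^(-1/4), which comes from evaluating at
    t/2. The late times then contribute at most L/2.\<close>
  have K: "0 < K" "12 * K \<le> 1 / 2"
    using \<epsilon> debye_const_pos by (auto simp: K_def field_simps)
  show ?case
  proof (rule tendsto_zero_iff_contraction[where M = "4 * \<epsilon>"])
    show "0 \<le> t powr (1/4) * Lp_distr_norm (4/3) (u t - v t)" for t
      by (simp add: Lp_distr_norm_def Lp_norm_nonneg)
    show "0 \<le> t powr (1/4) * Lp_norm (4/3) (heat t (u0 - v0))" for t
      by (simp add: Lp_norm_nonneg)
    show "t powr (1/4) * Lp_distr_norm (4/3) (u t - v t) \<le> 4 * \<epsilon>" if "0 < t" for t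
      by (rule small_mild_solutions_diff_bound[OF u v that])
  next
    fix T L \<delta> :: real
    assume T: "0 < T" and L: "0 < L" and \<delta>: "0 < \<delta>"
      and late: "\<And>\<tau>. T < \<tau> \<Longrightarrow> \<tau> powr (1/4) * Lp_distr_norm (4/3) (u \<tau> - v \<tau>) \<le> L"
    \<comment> \<open>\<open>D\<close> collects the contribution of times up to \<open>T\<close>,
      freed from its dependence on \<open>t\<close>. After multiplication by t^(1/4) that
      contribution is D t^(-1/2), which falls below any \<open>\<delta>\<close>.\<close>
    define D where "D = K * (4 * \<epsilon>) * (2 * T powr (1/2)) * (1/2) powr (-3/4)"
    have "((\<lambda>t. D * t powr (-1/2)) \<longlongrightarrow> D * 0) at_top"
      by (intro tendsto_mult tendsto_const tendsto_neg_powr filterlim_ident) auto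
    then have "eventually (\<lambda>t. D * t powr (-1/2) < \<delta>) at_top"
      using \<delta> by (intro order_tendstoD) auto
    moreover have "eventually (\<lambda>t. 2 * T \<le> t) at_top" by (rule eventually_ge_at_top)
    ultimately show "eventually (\<lambda>t. \<bar>t powr (1/4) * Lp_distr_norm (4/3) (u t - v t)
        - t powr (1/4) * Lp_norm (4/3) (heat t (u0 - v0))\<bar> \<le> \<delta> + L / 2) at_top"
    proof eventually_elim
      case (elim t)
      then have t: "0 < t" using T by linarith
      have half: "(t/2) powr a = t powr a * (1/2) powr a" for a
        using t powr_mult[of t "1/2" a] by simp
      have "\<bar>t powr (1/4) * Lp_distr_norm (4/3) (u t - v t) - t powr (1/4) * Lp_norm (4/3) (heat t (u0 - v0))\<bar>
        = t powr (1/4) * \<bar>Lp_distr_norm (4/3) (u t - v t) - Lp_norm (4/3) (heat t (u0 - v0))\<bar>"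
        by (simp add: abs_mult flip: right_diff_distrib)
      also have "\<dots> \<le> t powr (1/4) * (K * (4 * \<epsilon> * ((t/2) powr (-3/4) * (2 * T powr (1/2))) + L * (6 * (t/2) powr (-1/4))))"
        unfolding K_def
        by (intro mult_left_mono duhamel_difference_bound[OF u0 v0 u v \<epsilon>(1) T elim(2) L late]) auto
      also have "\<dots> = D * (t powr (1/4) * t powr (-3/4)) + K * L * (6 * (1/2) powr (-1/4)) * (t powr (1/4) * t powr (-1/4))"
        unfolding half D_def by (simp add: algebra_simps)
      also have "t powr (1/4) * t powr (-3/4) = t powr (-1/2)" by (simp flip: powr_add)
      also have "t powr (1/4) * t powr (-1/4) = 1" using t by (simp flip: powr_add)
      also have "D * t powr (-1/2) + K * L * (6 * (1/2) powr (-1/4)) * 1 \<le> \<delta> + K * L * (6 * 2)"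
      proof -
        have "(1/2::real) powr (-1/4) \<le> (1/2) powr (-1)" by (intro powr_mono') auto
        then have "(1/2::real) powr (-1/4) \<le> 2" by (simp add: powr_minus)
        then show ?thesis using elim K L by (intro add_mono) (auto intro!: mult_left_mono)
      qed
      also have "\<dots> \<le> \<delta> + L / 2"
        using mult_right_mono[OF K(2), of L] L by (simp add: ac_simps)
      finally show ?case .
    qed
  qed
qed

end
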